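(* For every constant $c>0$ there is a constant $C>0$ such that the following holds. Let $1/n\le\theta\le 1$ and $p\ge C n\log^4 n$, and let $X$ be an $n\times p$ Bernoulli–subgaussian random matrix with parameter $\theta$. Then $$\mathbb{P}\Big(\exists\, v\in\mathbb{R}^n:\ \big|\,\|X^T v\|_1-\mu_v\,\big|\ge c\,\mu_v\Big)=o(1)\quad\text{as } n\to\infty,$$ where $\mu_v:=\mathbb{E}\|X^Tv\|_1$.
   Context: An $n\times p$ Bernoulli–subgaussian random matrix with parameter $\theta\in(0,1]$ is a matrix $X=(x_{ij})$ with iid entries $x_{ij}=\chi_{ij}\xi_{ij}$, where the $\chi_{ij}$ are iid indicator random variables with $\mathbb{P}(\chi_{ij}=1)=\theta$, the $\xi_{ij}$ are iid random variables independent of the $\chi$'s, with mean $0$, variance at most $1$, $\mathbb{E}|\xi_{ij}|\in[1/10,1]$, and $\mathbb{P}(|\xi_{ij}|\ge t)\le 2\exp(-t^2/2)$ for all $t>0$. $\|\cdot\|_1$ is the $\ell_1$ norm.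
   Formalization: v ranges over nonzero vectors only, since for v=0 the event |0-0| ≥ c·0 always holds and the literal claim fails; C is stated per type of sample space, and uniformity over all spaces follows by passing to the joint law of the entries. *)

theory Defs
  imports "HOL-Probability.Probability"
begin

text \<open>Entries of the matrix are x i j = chi i j * xi i j, indices i < n (rows), j < p (columns).\<close>

definition bern_subgauss ::
  "'a measure \<Rightarrow> nat \<Rightarrow> nat \<Rightarrow> real \<Rightarrow> (nat \<Rightarrow> nat \<Rightarrow> 'a \<Rightarrow> real) \<Rightarrow> (nat \<Rightarrow> nat \<Rightarrow> 'a \<Rightarrow> real) \<Rightarrow> bool"
where
  "bern_subgauss M n p \<theta> chi xi \<longleftrightarrow>
     prob_space M \<and> 0 < \<theta> \<and> \<theta> \<le> 1 \<and>
     (\<forall>i<n. \<forall>j<p. chi i j \<in> borel_measurable M \<and> xi i j \<in> borel_measurable M) \<and>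
     prob_space.indep_vars M (\<lambda>_. borel)
        (\<lambda>k. case k of Inl (i, j) \<Rightarrow> chi i j | Inr (i, j) \<Rightarrow> xi i j)
        (Inl ` ({..<n} \<times> {..<p}) \<union> Inr ` ({..<n} \<times> {..<p})) \<and>
     (\<forall>i<n. \<forall>j<p. distr M borel (chi i j) = distr M borel (chi 0 0) \<and>
                   distr M borel (xi i j) = distr M borel (xi 0 0)) \<and>
     (\<forall>i<n. \<forall>j<p.
        (\<forall>\<omega>\<in>space M. chi i j \<omega> \<in> {0, 1}) \<and>
        measure M {\<omega>\<in>space M. chi i j \<omega> = 1} = \<theta> \<and>
        integrable M (xi i j) \<and>
        integral\<^sup>L M (xi i j) = 0 \<and>
        prob_space.variance M (xi i j) \<le> 1 \<and>
        1/10 \<le> integral\<^sup>L M (\<lambda>\<omega>. \<bar>xi i j \<omega>\<bar>) \<and>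
        integral\<^sup>L M (\<lambda>\<omega>. \<bar>xi i j \<omega>\<bar>) \<le> 1 \<and>
        (\<forall>t>0. measure M {\<omega>\<in>space M. \<bar>xi i j \<omega>\<bar> \<ge> t} \<le> 2 * exp (- t\<^sup>2 / 2)))"

definition l1_XTv :: "nat \<Rightarrow> nat \<Rightarrow> (nat \<Rightarrow> nat \<Rightarrow> 'a \<Rightarrow> real) \<Rightarrow> (nat \<Rightarrow> real) \<Rightarrow> 'a \<Rightarrow> real" where
  "l1_XTv n p X v \<omega> = (\<Sum>j<p. \<bar>\<Sum>i<n. X i j \<omega> * v i\<bar>)"

end

theory Submission
  imports Defs "HOL-Real_Asymp.Real_Asymp"
begin

text \<open>
  By homogeneity only \<open>v\<close> in the \<open>\<ell>\<^sub>1\<close> ball matter. Symmetrization and the contraction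
  principle for \<open>\<bar>\<cdot>\<bar>\<close> replace the deviation of \<open>\<Sum>\<^sub>j \<bar>\<langle>X\<^sub>j, v\<rangle>\<bar>\<close> by a signed
  sum of the columns \<open>X\<^sub>j\<close>, whose supremum over that ball is a maximum of \<open>n\<close> coordinates.
  Exponential moments bound its expectation by a constant times \<open>sqrt (p * \<theta>) * ln n\<close>.
  On the other hand the mean is at least a constant times \<open>p * sqrt (\<theta> / n)\<close> on the unit sphere
  of \<open>\<ell>\<^sub>1\<close>, so Markov's inequality gives a failure probability of order
  \<open>ln n * sqrt (n / p)\<close>, which is \<open>O(1 / ln n)\<close>; already \<open>C = 1\<close> works for every \<open>c\<close>.
\<close>

section \<open>Symmetrization and contraction\<close>

text \<open>The l1 scale is chosen because a linear form on that ball is controlled by single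
  coordinates, so the supremum costs a logarithm of \<open>n\<close> and not a power. The worst
  direction for the mean is the flat one: with all \<open>v i = 1 / n\<close>, the product with one
  column has variance at most \<open>\<theta> / n\<close>, which matches the order of the lower
  bound. In the ratio of \<open>sqrt (p * \<theta>)\<close> to
  \<open>p * sqrt (\<theta> / n)\<close> the parameter \<open>\<theta>\<close> cancels and
  \<open>sqrt (n / p)\<close> remains. Symmetrization is carried out one column at a time, random
  signs appearing only as averages of two values. This needs a bound that survives integration over
  each column in turn, hence a potential made of \<open>cosh\<close> terms and an estimate affine in
  it. The entries need not be symmetric, so the lower bound on the mean comes from duality with a
  bounded test function built from their signs. Uncountably many \<open>v\<close> are reached from
  finite sets through a countable dense set, because the bound does not depend on the finite
  set.\<close>

lemma integrable_Max_finite: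
  fixes f :: "'v \<Rightarrow> 'b \<Rightarrow> real"
  assumes "finite V" "V \<noteq> {}" "\<And>v. v \<in> V \<Longrightarrow> integrable M (f v)"
  shows "integrable M (\<lambda>x. Max ((\<lambda>v. f v x) ` V))"
  using assms
proof (induction V rule: finite_ne_induct)
  case (insert v V)
  then have "integrable M (\<lambda>x. max (f v x) (Max ((\<lambda>v. f v x) ` V)))"
    by (intro integrable_max) auto
  with insert show ?case by simp
qed simp

text \<open>Let \<open>v\<close> and \<open>w\<close> be maximizers on the left. The sign of
  \<open>a v\<close> tells in which maximum on the right \<open>v\<close> contributes
  \<open>g v + \<bar>a v\<bar>\<close>; in the other one \<open>w\<close> contributes at least
  \<open>g w - \<bar>a w\<bar>\<close>.\<close>

lemma Max_abs_contraction:
  fixes g a :: "'v \<Rightarrow> real"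
  assumes V: "finite V" "V \<noteq> {}"
  shows "Max ((\<lambda>v. g v + \<bar>a v\<bar>) ` V) + Max ((\<lambda>v. g v - \<bar>a v\<bar>) ` V)
       \<le> Max ((\<lambda>v. g v + a v) ` V) + Max ((\<lambda>v. g v - a v) ` V)"
proof -
  have "Max ((\<lambda>v. g v + \<bar>a v\<bar>) ` V) \<in> (\<lambda>v. g v + \<bar>a v\<bar>) ` V"
    using V by (intro Max_in) auto
  then obtain v where v: "v \<in> V" "Max ((\<lambda>v. g v + \<bar>a v\<bar>) ` V) = g v + \<bar>a v\<bar>" by auto
  have "Max ((\<lambda>v. g v - \<bar>a v\<bar>) ` V) \<in> (\<lambda>v. g v - \<bar>a v\<bar>) ` V"
    using V by (intro Max_in) auto
  then obtain w where w: "w \<in> V" "Max ((\<lambda>v. g v - \<bar>a v\<bar>) ` V) = g w - \<bar>a w\<bar>" by auto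
  have P: "g x + a x \<le> Max ((\<lambda>v. g v + a v) ` V)" "g x - a x \<le> Max ((\<lambda>v. g v - a v) ` V)"
    if "x \<in> V" for x
    using V that by (auto intro!: Max_ge)
  show ?thesis
    using P[OF v(1)] P[OF w(1)] unfolding v(2) w(2) by linarith
qed

text \<open>The centering is split by convexity, without introducing an independent copy of the
  column: each candidate value is the average of one with twice the positive part and the mean
  of one with twice the negative part.\<close>

lemma symmetrize_one:
  fixes a :: "'v \<Rightarrow> 'b \<Rightarrow> real"
  assumes D: "prob_space D" and V: "finite V" "V \<noteq> {}"
    and int: "\<And>v. v \<in> V \<Longrightarrow> integrable D (a v)" and s: "s \<in> {1, -1}"
  shows "(\<integral>x. Max ((\<lambda>v. g v + s * (\<bar>a v x\<bar> - (\<integral>y. \<bar>a v y\<bar> \<partial>D))) ` V) \<partial>D)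
     \<le> ((\<integral>x. Max ((\<lambda>v. g v + 2 * a v x) ` V) \<partial>D)
        + (\<integral>x. Max ((\<lambda>v. g v - 2 * a v x) ` V) \<partial>D)) / 2"
proof -
  interpret prob_space D by fact
  define P where "P r x = Max ((\<lambda>v. g v + r * (2 * \<bar>a v x\<bar>)) ` V)" for r x
  have intP: "integrable D (P r)" for r
    unfolding P_def using V int by (intro integrable_Max_finite) auto
  have intM: "integrable D (\<lambda>x. Max ((\<lambda>v. g v + r * (2 * a v x)) ` V))" for r
    using V int by (intro integrable_Max_finite) auto
  have PI: "g v + r * (2 * \<bar>a v x\<bar>) \<le> P r x" if "v \<in> V" for r v x
    unfolding P_def using V that by (auto intro!: Max_ge)
  have pw: "g v + s * (\<bar>a v x\<bar> - (\<integral>y. \<bar>a v y\<bar> \<partial>D)) \<le> P s x / 2 + (\<integral>y. P (-s) y \<partial>D) / 2"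
    if v: "v \<in> V" for v x
  proof -
    have "(\<integral>y. g v + (-s) * (2 * \<bar>a v y\<bar>) \<partial>D) \<le> (\<integral>y. P (-s) y \<partial>D)"
      by (intro integral_mono intP) (use int[OF v] PI[OF v, of "-s"] in auto)
    also have "(\<integral>y. g v + (-s) * (2 * \<bar>a v y\<bar>) \<partial>D) = g v - 2 * s * (\<integral>y. \<bar>a v y\<bar> \<partial>D)"
      using int[OF v] by (simp add: prob_space)
    finally show ?thesis using PI[OF v, of s x] by (simp add: algebra_simps)
  qed
  have "(\<integral>x. Max ((\<lambda>v. g v + s * (\<bar>a v x\<bar> - (\<integral>y. \<bar>a v y\<bar> \<partial>D))) ` V) \<partial>D)
     \<le> (\<integral>x. P s x / 2 + (\<integral>y. P (-s) y \<partial>D) / 2 \<partial>D)"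
    by (intro integral_mono integrable_Max_finite)
       (use V int intP pw in \<open>auto simp: Max_le_iff\<close>)
  also have "\<dots> = ((\<integral>x. P s x \<partial>D) + (\<integral>y. P (-s) y \<partial>D)) / 2"
    using intP by (simp add: prob_space add_divide_distrib)
  \<comment> \<open>Since \<open>{s, -s} = {1, -1}\<close>, the sign drops out; both means are over
    the same law, so they merge into one integral and the contraction applies pointwise.\<close>
  also have "\<dots> = (\<integral>x. P 1 x + P (-1) x \<partial>D) / 2"
    using s intP by auto
  also have "\<dots> \<le> (\<integral>x. Max ((\<lambda>v. g v + 1 * (2 * a v x)) ` V)
                     + Max ((\<lambda>v. g v + (-1) * (2 * a v x)) ` V) \<partial>D) / 2"
  proof (intro divide_right_mono integral_mono)
    fix x
    show "P 1 x + P (- 1) x \<le> Max ((\<lambda>v. g v + 1 * (2 * a v x)) ` V)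
                     + Max ((\<lambda>v. g v + (-1) * (2 * a v x)) ` V)"
      using Max_abs_contraction[OF V, of g "\<lambda>v. 2 * a v x"] by (simp add: P_def abs_mult)
  qed (use intP intM[of 1] intM[of "-1"] in auto)
  also have "\<dots> = ((\<integral>x. Max ((\<lambda>v. g v + 2 * a v x) ` V) \<partial>D)
        + (\<integral>x. Max ((\<lambda>v. g v - 2 * a v x) ` V) \<partial>D)) / 2"
    using intM[of 1] intM[of "-1"] by simp
  finally show ?thesis .
qed

section \<open>Maxima over the l1 ball, one column at a time\<close>

definition lin :: "nat \<Rightarrow> (nat \<Rightarrow> real) \<Rightarrow> (nat \<Rightarrow> real) \<Rightarrow> real" where
  "lin n v x = (\<Sum>i<n. x i * v i)"

lemma cosh_ge_half_exp_abs: "exp \<bar>x\<bar> \<le> 2 * cosh (x::real)"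
  by (cases "x \<ge> 0") (auto simp: cosh_def)

text \<open>A smooth upper bound for \<open>2 * (MAX i. \<bar>u i\<bar>)\<close>: the logarithm in the usual
  log-sum-exp bound is replaced by its tangent at \<open>t\<close>, so that it commutes with expectations.\<close>

lemma lin_le_softmax:
  fixes u v :: "nat \<Rightarrow> real"
  assumes n: "0 < n" and v: "(\<Sum>i<n. \<bar>v i\<bar>) \<le> 1" and m: "m > 0" and t: "t > 0"
  shows "2 * lin n v u \<le> 2 / m * (2 * (\<Sum>i<n. cosh (m * u i)) / t + ln t - 1)"
proof -
  define c where "c = (2 * (\<Sum>i<n. cosh (m * u i)) / t + ln t - 1) / m"
  have uc: "\<bar>u i\<bar> \<le> c" if i: "i < n" for i
  proof -
    define z where "z = 2 * (\<Sum>i<n. cosh (m * u i))"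
    have "2 * cosh (m * u i) \<le> z"
      unfolding z_def using i by (intro mult_left_mono member_le_sum) (auto simp: cosh_real_nonneg)
    then have z: "exp \<bar>m * u i\<bar> \<le> z" using cosh_ge_half_exp_abs[of "m * u i"] by linarith
    then have z0: "z > 0" by (meson exp_gt_zero less_le_trans)
    have "m * \<bar>u i\<bar> \<le> ln z" using z z0 m by (subst ln_ge_iff) (auto simp: abs_mult)
    also have "ln z = ln (z / t) + ln t" using z0 t by (simp add: ln_div)
    also have "\<dots> \<le> z / t - 1 + ln t" using ln_le_minus_one[of "z / t"] z0 t by simp
    finally show ?thesis unfolding c_def z_def using m by (simp add: field_simps)
  qed
  have c0: "c \<ge> 0" using uc[OF n] by linarith
  have "lin n v u \<le> (\<Sum>i<n. c * \<bar>v i\<bar>)"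
    unfolding lin_def
  proof (intro sum_mono)
    fix i assume "i \<in> {..<n}"
    then have "u i * v i \<le> \<bar>u i\<bar> * \<bar>v i\<bar>" by (metis abs_ge_self abs_mult)
    also have "\<dots> \<le> c * \<bar>v i\<bar>" using uc[of i] \<open>i \<in> {..<n}\<close> by (intro mult_right_mono) auto
    finally show "u i * v i \<le> c * \<bar>v i\<bar>" .
  qed
  also have "\<dots> = c * (\<Sum>i<n. \<bar>v i\<bar>)" by (simp add: sum_distrib_left)
  also have "\<dots> \<le> c" using v c0 by (metis mult.right_neutral mult_left_mono)
  finally show ?thesis using m unfolding c_def by (simp add: field_simps)
qed

text \<open>Averaging over a signed step multiplies \<open>cosh\<close> by \<open>cosh\<close> of
  the step, so a sum of \<open>cosh\<close> terms acts as a multiplicative potential along the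
  columns.\<close>

lemma cosh_add_plus_diff: "cosh (x + y) + cosh (x - y) = 2 * cosh x * cosh (y::real)"
  by (simp add: cosh_add cosh_diff)

lemma integrable_pair_fst:
  fixes f :: "'b \<Rightarrow> real"
  assumes "prob_space N" "integrable M f"
  shows "integrable (M \<Otimes>\<^sub>M N) (\<lambda>z. f (fst z))"
proof -
  have "integrable (distr (M \<Otimes>\<^sub>M N) M fst) f"
    using assms by (simp add: prob_space.distr_pair_fst)
  then show ?thesis by (rule integrable_distr[rotated]) measurable
qed

lemma integrable_pair_snd:
  fixes f :: "'b \<Rightarrow> real"
  assumes M: "prob_space M" and N: "prob_space N" and f: "integrable N f"
  shows "integrable (M \<Otimes>\<^sub>M N) (\<lambda>z. f (snd z))"
proof -
  interpret M: prob_space M by fact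
  interpret N: prob_space N by fact
  interpret pair_sigma_finite N M ..
  show ?thesis
    using integrable_product_swap[OF integrable_pair_fst[OF M f]] by (simp add: split_beta')
qed

text \<open>Columns already treated have become linear and sit in \<open>u\<close>; those in
  \<open>J\<close> still carry centered absolute values. Removing column \<open>k\<close> moves
  \<open>u\<close> to \<open>u + y\<close> or \<open>u - y\<close> with equal weight, so
  \<open>u\<close> must be arbitrary in the induction; the \<open>2\<close> in front of
  \<open>lin n v u\<close> is the factor created by \<open>symmetrize_one\<close>. The bound is
  affine in the potential, hence can be integrated over \<open>y\<close>, and each column costs one
  factor \<open>K\<close>.\<close>

lemma expectation_Max_le:
  fixes D :: "nat \<Rightarrow> (nat \<Rightarrow> real) measure"
  assumes D: "\<And>j. prob_space (D j)" and n: "0 < n" and m: "m > 0" and t: "t > 0"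
    and V: "finite V" "V \<noteq> {}" "\<And>v. v \<in> V \<Longrightarrow> (\<Sum>i<n. \<bar>v i\<bar>) \<le> 1"
    and int: "\<And>i j. i < n \<Longrightarrow> integrable (D j) (\<lambda>x. x i)"
    and intc: "\<And>i j. i < n \<Longrightarrow> integrable (D j) (\<lambda>x. cosh (m * x i))"
    and K: "\<And>i j. i < n \<Longrightarrow> (\<integral>x. cosh (m * x i) \<partial>D j) \<le> K" and K1: "K \<ge> 0"
    and s: "s \<in> {1, -1}" and J: "finite J"
  shows "(\<integral>X. Max ((\<lambda>v. 2 * lin n v u
              + s * (\<Sum>j\<in>J. \<bar>lin n v (X j)\<bar> - (\<integral>y. \<bar>lin n v y\<bar> \<partial>D j))) ` V) \<partial>PiM J D)
        \<le> 2 / m * (2 * K ^ card J * (\<Sum>i<n. cosh (m * u i)) / t + ln t - 1)"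
  using J
proof (induction J arbitrary: u rule: finite_induct)
  case empty
  interpret prob_space "PiM {} D" by (intro prob_space_PiM D)
  show ?case
    using V lin_le_softmax[OF n V(3) m t, of _ u] by (simp add: prob_space Max_le_iff)
next
  case (insert k J)
  interpret product_prob_space D using D by (simp add: product_prob_spaceI)
  interpret PJ: prob_space "PiM J D" by (intro prob_space_PiM D)
  interpret pair_sigma_finite "PiM J D" "D k" ..
  have lin_int: "integrable (D j) (\<lambda>y. lin n v y)" for j v
    unfolding lin_def by (intro Bochner_Integration.integrable_sum integrable_mult_left int) simp
  have lin_int': "integrable (PiM I D) (\<lambda>X. \<bar>lin n v (X j)\<bar>)" if "j \<in> I" for j v I
  proof -
    have "integrable (distr (PiM I D) (D j) (\<lambda>X. X j)) (\<lambda>y. \<bar>lin n v y\<bar>)"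
      unfolding distr_PiM_component[where M = D, OF D that] by (intro integrable_abs lin_int)
    then show ?thesis
      by (rule integrable_distr[rotated]) (use that in measurable)
  qed
  define h where "h I v X = s * (\<Sum>j\<in>I. \<bar>lin n v (X j)\<bar> - (\<integral>y. \<bar>lin n v y\<bar> \<partial>D j))" for I v X
  have h_int: "integrable (PiM I D) (h I v)" for I v
  proof -
    interpret PI: prob_space "PiM I D" by (intro prob_space_PiM D)
    show ?thesis
      unfolding h_def by (auto intro!: Bochner_Integration.integrable_sum lin_int')
  qed
  \<comment> \<open>Column \<open>k\<close> is linear here, with sign \<open>r\<close>, while the
    columns in \<open>J\<close> are still untreated.\<close>
  define R where "R = (\<lambda>r X y. Max ((\<lambda>v. 2 * lin n v u + h J v X + r * (2 * lin n v y)) ` V))"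
  have R_int: "integrable (PiM J D \<Otimes>\<^sub>M D k) (case_prod (R r))" for r
    unfolding R_def split_beta'
    by (intro integrable_Max_finite V Bochner_Integration.integrable_add integrable_mult_right
          integrable_pair_fst[where f = "h J _"] integrable_pair_snd[where f = "lin n _"]
          prob_space_PiM D h_int lin_int
          finite_measure.integrable_const prob_space.finite_measure prob_space_pair)
  define G where "G u = 2 / m * (2 * K ^ card J * (\<Sum>i<n. cosh (m * u i)) / t + ln t - 1)" for u
  have IH: "(\<integral>X. Max ((\<lambda>v. 2 * lin n v u + h J v X) ` V) \<partial>PiM J D) \<le> G u" for u
    unfolding h_def G_def by (rule insert.IH)
  have G_int: "integrable (D k) (\<lambda>y. G (\<lambda>i. u i + r * y i))" if "r \<in> {1, -1}" for r
  proof -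
    have "integrable (D k) (\<lambda>y. cosh (m * (u i + r * y i)))" if "i < n" for i
    proof (rule Bochner_Integration.integrable_bound)
      show "integrable (D k) (\<lambda>y. 2 * cosh (m * u i) * cosh (m * y i))"
        using intc[OF that] by simp
      show "(\<lambda>y. cosh (m * (u i + r * y i))) \<in> borel_measurable (D k)"
        using borel_measurable_integrable[OF int[OF that]] by (simp add: cosh_def)
      \<comment> \<open>The term with the opposite sign is positive; adding it gives a product whose
        dependence on \<open>y\<close> is integrable by \<open>intc\<close>.\<close>
      have "cosh (m * (u i + r * y i)) \<le> 2 * cosh (m * u i) * cosh (m * y i)" for y
        unfolding cosh_add_plus_diff[symmetric] using \<open>r \<in> {1, -1}\<close> by (auto simp: algebra_simps)
      then show "AE y in D k. norm (cosh (m * (u i + r * y i)))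
          \<le> norm (2 * cosh (m * u i) * cosh (m * y i))"
        by (simp add: cosh_real_nonneg)
    qed
    then show ?thesis
      unfolding G_def by (intro integrable_mult_right Bochner_Integration.integrable_diff
        Bochner_Integration.integrable_add integrable_divide_zero Bochner_Integration.integrable_sum
        finite_measure.integrable_const[OF prob_space.finite_measure[OF D]]) auto
  qed
  have R_le: "(\<integral>X. (\<integral>y. R r X y \<partial>D k) \<partial>PiM J D) \<le> (\<integral>y. G (\<lambda>i. u i + r * y i) \<partial>D k)"
    if r: "r \<in> {1, -1}" for r
  proof -
    \<comment> \<open>Symmetrizing needed the columns in \<open>J\<close> fixed and \<open>y\<close>
      integrated first; the induction hypothesis needs \<open>y\<close> fixed and those columns
      integrated first.\<close>
    have "(\<integral>X. (\<integral>y. R r X y \<partial>D k) \<partial>PiM J D) = (\<integral>y. (\<integral>X. R r X y \<partial>PiM J D) \<partial>D k)"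
      by (rule Fubini_integral[OF R_int, symmetric])
    also have "\<dots> \<le> (\<integral>y. G (\<lambda>i. u i + r * y i) \<partial>D k)"
    proof (intro integral_mono integrable_snd[OF R_int] G_int[OF r])
      fix y
      have "2 * lin n v (\<lambda>i. u i + r * y i) + h J v X = 2 * lin n v u + h J v X + r * (2 * lin n v y)"
        for v X
        unfolding lin_def by (simp add: algebra_simps sum.distrib sum_distrib_left)
      with IH[of "\<lambda>i. u i + r * y i"]
      show "(\<integral>X. R r X y \<partial>PiM J D) \<le> G (\<lambda>i. u i + r * y i)"
        unfolding R_def by simp
    qed
    finally show ?thesis .
  qed
  have "(\<integral>X. Max ((\<lambda>v. 2 * lin n v u + h (insert k J) v X) ` V) \<partial>PiM (insert k J) D)
      = (\<integral>X. (\<integral>y. Max ((\<lambda>v. 2 * lin n v u + h (insert k J) v (X(k := y))) ` V) \<partial>D k) \<partial>PiM J D)"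
  proof (intro product_integral_insert insert.hyps integrable_Max_finite V(1,2))
    interpret PkJ: prob_space "PiM (insert k J) D" by (intro prob_space_PiM D)
    show "integrable (PiM (insert k J) D) (\<lambda>X. 2 * lin n v u + h (insert k J) v X)" for v
      using h_int[of "insert k J" v] by simp
  qed
  also have "\<dots> = (\<integral>X. (\<integral>y. Max ((\<lambda>v. (2 * lin n v u + h J v X)
        + s * (\<bar>lin n v y\<bar> - (\<integral>y. \<bar>lin n v y\<bar> \<partial>D k))) ` V) \<partial>D k) \<partial>PiM J D)"
  proof -
    have "h (insert k J) v (X(k := y)) = h J v X + s * (\<bar>lin n v y\<bar> - (\<integral>y. \<bar>lin n v y\<bar> \<partial>D k))"
      for v X y
    proof -
      have "(\<Sum>j\<in>J. \<bar>lin n v ((X(k := y)) j)\<bar> - (\<integral>y. \<bar>lin n v y\<bar> \<partial>D j))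
          = (\<Sum>j\<in>J. \<bar>lin n v (X j)\<bar> - (\<integral>y. \<bar>lin n v y\<bar> \<partial>D j))"
        using insert.hyps by (intro sum.cong) auto
      then show ?thesis using insert.hyps unfolding h_def by (simp add: algebra_simps)
    qed
    then show ?thesis by (simp add: add.assoc)
  qed
  also have "\<dots> \<le> (\<integral>X. ((\<integral>y. R 1 X y \<partial>D k) + (\<integral>y. R (-1) X y \<partial>D k)) / 2 \<partial>PiM J D)"
  proof (intro integral_mono)
    have "integrable (PiM J D \<Otimes>\<^sub>M D k) (\<lambda>(X, y). Max ((\<lambda>v. (2 * lin n v u + h J v X)
        + s * (\<bar>lin n v y\<bar> - (\<integral>y. \<bar>lin n v y\<bar> \<partial>D k))) ` V))"
      unfolding split_beta'
      by (intro integrable_Max_finite V Bochner_Integration.integrable_add integrable_mult_right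
          integrable_pair_fst[where f = "h J _"]
          integrable_pair_snd[where f = "\<lambda>y. \<bar>lin n _ y\<bar> - (\<integral>y. \<bar>lin n _ y\<bar> \<partial>D k)"]
          Bochner_Integration.integrable_diff integrable_abs
          prob_space_PiM D h_int lin_int
          finite_measure.integrable_const prob_space.finite_measure prob_space_pair)
    from integrable_fst[OF this]
    show "integrable (PiM J D) (\<lambda>X. \<integral>y. Max ((\<lambda>v. (2 * lin n v u + h J v X)
        + s * (\<bar>lin n v y\<bar> - (\<integral>y. \<bar>lin n v y\<bar> \<partial>D k))) ` V) \<partial>D k)" .
    show "integrable (PiM J D) (\<lambda>X. ((\<integral>y. R 1 X y \<partial>D k) + (\<integral>y. R (-1) X y \<partial>D k)) / 2)"
      using integrable_fst[OF R_int[of 1]] integrable_fst[OF R_int[of "-1"]] by simp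
    fix X
    show "(\<integral>y. Max ((\<lambda>v. (2 * lin n v u + h J v X)
        + s * (\<bar>lin n v y\<bar> - (\<integral>y. \<bar>lin n v y\<bar> \<partial>D k))) ` V) \<partial>D k)
        \<le> ((\<integral>y. R 1 X y \<partial>D k) + (\<integral>y. R (-1) X y \<partial>D k)) / 2"
      using symmetrize_one[OF D V(1,2) lin_int s, of k "\<lambda>v. 2 * lin n v u + h J v X"]
      unfolding R_def by simp
  qed
  also have "\<dots> = ((\<integral>X. (\<integral>y. R 1 X y \<partial>D k) \<partial>PiM J D) + (\<integral>X. (\<integral>y. R (-1) X y \<partial>D k) \<partial>PiM J D)) / 2"
    using integrable_fst[OF R_int[of 1]] integrable_fst[OF R_int[of "-1"]] by simp
  also have "\<dots> \<le> ((\<integral>y. G (\<lambda>i. u i + 1 * y i) \<partial>D k) + (\<integral>y. G (\<lambda>i. u i + (-1) * y i) \<partial>D k)) / 2"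
    by (intro divide_right_mono add_mono R_le) auto
  also have "\<dots> = (\<integral>y. (G (\<lambda>i. u i + 1 * y i) + G (\<lambda>i. u i + (-1) * y i)) / 2 \<partial>D k)"
    using G_int[of 1] G_int[of "-1"] by simp
  \<comment> \<open>Averaging over the two signs cancels the products of \<open>sinh\<close>,
    whatever the law of \<open>y\<close>.\<close>
  also have "\<dots> = (\<integral>y. 2 / m * (2 * K ^ card J * (\<Sum>i<n. cosh (m * u i) * cosh (m * y i)) / t + ln t - 1) \<partial>D k)"
  proof -
    have "(G (\<lambda>i. u i + 1 * y i) + G (\<lambda>i. u i + (-1) * y i)) / 2
       = 2 / m * (2 * K ^ card J * (\<Sum>i<n. (cosh (m * u i + m * y i) + cosh (m * u i - m * y i)) / 2) / t + ln t - 1)" for y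
      unfolding G_def sum_divide_distrib[symmetric] sum.distrib using m t
      by (simp add: field_simps)
    moreover have "(cosh (m * u i + m * y i) + cosh (m * u i - m * y i)) / 2 = cosh (m * u i) * cosh (m * y i)"
      for y i by (simp add: cosh_add_plus_diff)
    ultimately show ?thesis by (simp only:)
  qed
  also have "\<dots> = 2 / m * (2 * K ^ card J * (\<Sum>i<n. cosh (m * u i) * (\<integral>y. cosh (m * y i) \<partial>D k)) / t + ln t - 1)"
  proof -
    define c where "c y = (\<Sum>i<n. cosh (m * u i) * cosh (m * y i))" for y
    have "integrable (D k) c"
      unfolding c_def using intc by (intro Bochner_Integration.integrable_sum) auto
    moreover have "integral\<^sup>L (D k) c = (\<Sum>i<n. cosh (m * u i) * (\<integral>y. cosh (m * y i) \<partial>D k))"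
      unfolding c_def using intc by (subst Bochner_Integration.integral_sum) auto
    ultimately show ?thesis
      unfolding c_def[symmetric] using prob_space.prob_space[OF D, of k]
      by simp
  qed
  also have "\<dots> \<le> 2 / m * (2 * K ^ card J * (\<Sum>i<n. cosh (m * u i) * K) / t + ln t - 1)"
    using m t K1 K
    by (intro mult_left_mono diff_right_mono add_right_mono divide_right_mono sum_mono) 
       (auto simp: cosh_real_nonneg)
  also have "\<dots> = 2 / m * (2 * K ^ card (insert k J) * (\<Sum>i<n. cosh (m * u i)) / t + ln t - 1)"
    using insert.hyps by (simp add: sum_distrib_right[symmetric] mult.assoc mult.commute[of K])
  finally show ?case unfolding h_def .
qed

section \<open>Lower bound for the mean\<close>

text \<open>The range of \<open>g\<close> is a general normed field because the same identity serves
  real moments and the complex factors of the Riesz product.\<close>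

lemma (in prob_space) expectation_bernoulli_mult:
  fixes g :: "real \<Rightarrow> 'b :: {real_normed_field, banach, second_countable_topology}"
  assumes ind: "indep_var borel chi borel xi"
    and chi_01: "\<And>\<omega>. \<omega> \<in> space M \<Longrightarrow> chi \<omega> \<in> {0, 1}"
    and \<theta>: "prob {\<omega> \<in> space M. chi \<omega> = 1} = \<theta>"
    and g: "g \<in> borel_measurable borel" and int: "integrable M (\<lambda>\<omega>. g (xi \<omega>))"
  shows "integrable M (\<lambda>\<omega>. of_real (chi \<omega>) * g (xi \<omega>))" (is ?int)
    and "(\<integral>\<omega>. of_real (chi \<omega>) * g (xi \<omega>) \<partial>M) = of_real \<theta> * (\<integral>\<omega>. g (xi \<omega>) \<partial>M)" (is ?eq)
proof -
  have m[measurable]: "chi \<in> borel_measurable M" "xi \<in> borel_measurable M"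
    using ind by (auto dest: indep_var_rv1 indep_var_rv2)
  have eq: "chi \<omega> = indicator {\<omega> \<in> space M. chi \<omega> = 1} \<omega>" if "\<omega> \<in> space M" for \<omega>
    using chi_01[OF that] that by (auto simp: indicator_def)
  have int0: "integrable M chi"
    by (intro integrable_const_bound[where B = 1] AE_I2 m) (use chi_01 in force)
  then have int1: "integrable M (\<lambda>\<omega>. of_real (chi \<omega>) :: 'b)"
    by (rule integrable_of_real)
  have "(\<integral>\<omega>. chi \<omega> \<partial>M) = (\<integral>\<omega>. indicator {\<omega> \<in> space M. chi \<omega> = 1} \<omega> \<partial>M)"
    by (intro Bochner_Integration.integral_cong refl eq)
  also have "\<dots> = \<theta>" using \<theta> by simp
  finally have E: "(\<integral>\<omega>. of_real (chi \<omega>) \<partial>M) = (of_real \<theta> :: 'b)"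
    using integral_bounded_linear[OF bounded_linear_of_real int0] by simp
  have "indep_var borel (of_real \<circ> chi :: _ \<Rightarrow> 'b) borel (g \<circ> xi)"
    by (rule indep_var_compose[OF ind _ g]) simp
  then have i: "indep_var borel (\<lambda>\<omega>. of_real (chi \<omega>) :: 'b) borel (\<lambda>\<omega>. g (xi \<omega>))"
    by (simp add: comp_def)
  show ?int by (rule indep_var_integrable[OF i int1 int])
  show ?eq using indep_var_lebesgue_integral[OF i int1 int] E by simp
qed

text \<open>Testing against the imaginary part of a Riesz product. Each factor has norm at most
  \<open>1\<close> and the real mean \<open>\<rho>\<close>; the subtraction of the mean of \<open>sgn xi\<close>
  removes the cross terms.\<close>

lemma (in prob_space) riesz_product_lower_bound:
  fixes chi xi :: "nat \<Rightarrow> 'a \<Rightarrow> real"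
  assumes ind: "indep_vars (\<lambda>_. borel \<Otimes>\<^sub>M borel) (\<lambda>k \<omega>. (chi k \<omega>, xi k \<omega>)) {..<n}"
    and ind2: "\<And>k. k < n \<Longrightarrow> indep_var borel (chi k) borel (xi k)"
    and chi_01: "\<And>k \<omega>. k < n \<Longrightarrow> \<omega> \<in> space M \<Longrightarrow> chi k \<omega> \<in> {0, 1}"
    and \<theta>: "\<And>k. k < n \<Longrightarrow> prob {\<omega> \<in> space M. chi k \<omega> = 1} = \<theta>"
    and int: "\<And>k. k < n \<Longrightarrow> integrable M (xi k)"
    and mean: "\<And>k. k < n \<Longrightarrow> expectation (xi k) = 0"
    and b: "b > 0"
  defines "R \<equiv> sqrt (1 + 4 * b\<^sup>2)"
  defines "\<rho> \<equiv> 1 - \<theta> + \<theta> / R"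
  shows "(\<Sum>j<n. \<bar>v j\<bar> * (\<theta> * b * expectation (\<lambda>\<omega>. \<bar>xi j \<omega>\<bar>) / R * \<rho> ^ (n - 1)))
      \<le> expectation (\<lambda>\<omega>. \<bar>\<Sum>j<n. chi j \<omega> * xi j \<omega> * v j\<bar>)"
proof -
  define m where "m k = expectation (\<lambda>\<omega>. sgn (xi k \<omega>))" for k
  define \<psi> where "\<psi> k x = b * sgn (v k) * (sgn x - m k)" for k x
  \<comment> \<open>The factor is \<open>1\<close> when the entry vanishes, so division by
    \<open>R\<close> is paid only with probability \<open>\<theta>\<close>. Hence the product of the
    means stays bounded below even for \<open>b\<close> of order
    \<open>1 / sqrt (n * \<theta>)\<close>.\<close>
  define F where "F k = (\<lambda>(c, x). of_real (1 - c) + of_real c * (1 + \<i> * of_real (\<psi> k x)) / of_real R)"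
    for k :: nat
  define \<phi> where "\<phi> k \<omega> = F k (chi k \<omega>, xi k \<omega>)" for k \<omega>
  have R0: "R > 0" unfolding R_def by (simp add: add_pos_nonneg)
  have mXi[measurable]: "xi k \<in> borel_measurable M" "chi k \<in> borel_measurable M" if "k < n" for k
    using ind2[OF that] by (auto dest: indep_var_rv1 indep_var_rv2)
  have int_sgn: "integrable M (\<lambda>\<omega>. sgn (xi k \<omega>))" if "k < n" for k
    by (rule integrable_const_bound[where B = 1]) (use that in \<open>auto simp: sgn_real_def\<close>)
  have m_le: "\<bar>m k\<bar> \<le> 1" if "k < n" for k
  proof -
    have "\<bar>m k\<bar> \<le> expectation (\<lambda>\<omega>. \<bar>sgn (xi k \<omega>)\<bar>)"
      unfolding m_def by (rule integral_abs_bound)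
    also have "\<dots> \<le> expectation (\<lambda>_. 1)"
      by (intro integral_mono integrable_abs int_sgn that integrable_const) (auto simp: sgn_real_def)
    finally show ?thesis by (simp add: prob_space)
  qed
  have \<psi>_meas[measurable]: "\<psi> k \<in> borel_measurable borel" for k
    unfolding \<psi>_def by measurable
  have F_meas[measurable]: "F k \<in> borel_measurable (borel \<Otimes>\<^sub>M borel)" for k
    unfolding F_def by measurable
  have \<psi>_le: "\<bar>\<psi> k x\<bar> \<le> 2 * b" if "k < n" for k x
  proof -
    \<comment> \<open>This \<open>2\<close> is the origin of \<open>4 * b\<^sup>2\<close> in
      \<open>R\<close>.\<close>
    have "\<bar>sgn x - m k\<bar> \<le> 2" using m_le[OF that] by (auto simp: sgn_real_def)
    then have "\<bar>sgn (v k)\<bar> * \<bar>sgn x - m k\<bar> \<le> 1 * 2"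
      by (intro mult_mono) (auto simp: sgn_real_def)
    then show ?thesis using b unfolding \<psi>_def by (simp add: abs_mult mult.assoc)
  qed
  have \<phi>_le: "norm (\<phi> k \<omega>) \<le> 1" if k: "k < n" and \<omega>: "\<omega> \<in> space M" for k \<omega>
  proof (cases "chi k \<omega> = 0")
    case False
    then have "chi k \<omega> = 1" using chi_01[OF k \<omega>] by auto
    moreover have "norm (1 + \<i> * of_real (\<psi> k (xi k \<omega>))) \<le> R"
    proof -
      have "(\<psi> k (xi k \<omega>))\<^sup>2 \<le> (2 * b)\<^sup>2" using \<psi>_le[OF k] b by (intro abs_le_square_iff[THEN iffD1]) auto
      then show ?thesis unfolding R_def by (simp add: norm_complex_def power_mult_distrib)
    qed
    ultimately show ?thesis using R0 by (simp add: \<phi>_def F_def norm_divide)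
  qed (simp add: \<phi>_def F_def)
  have \<phi>_meas[measurable]: "\<phi> k \<in> borel_measurable M" if "k < n" for k
    unfolding \<phi>_def using that by measurable
  have int_phi: "integrable M (\<phi> k)" if "k < n" for k
    by (rule integrable_const_bound[where B = 1]) (use that \<phi>_le in auto)
  have int_\<psi>: "integrable M (\<lambda>\<omega>. \<psi> k (xi k \<omega>))" "expectation (\<lambda>\<omega>. \<psi> k (xi k \<omega>)) = 0" if "k < n" for k
    unfolding \<psi>_def using int_sgn[OF that] by (auto simp: m_def[symmetric] prob_space)
  have E\<phi>: "integral\<^sup>L M (\<phi> k) = of_real \<rho>" if k: "k < n" for k
  proof -
    let ?g = "\<lambda>x. (1 + \<i> * of_real (\<psi> k x)) / of_real R - 1"
    have int_g: "integrable M (\<lambda>\<omega>. ?g (xi k \<omega>))"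
      using int_\<psi>[OF k] by auto
    note E = expectation_bernoulli_mult[OF ind2[OF k] chi_01[OF k] \<theta>[OF k] _ int_g]
    have g: "?g \<in> borel_measurable borel" by measurable
    have "\<phi> k = (\<lambda>\<omega>. 1 + of_real (chi k \<omega>) * ?g (xi k \<omega>))"
      by (simp add: \<phi>_def F_def fun_eq_iff algebra_simps)
    then have "integral\<^sup>L M (\<phi> k) = (\<integral>\<omega>. 1 + of_real (chi k \<omega>) * ?g (xi k \<omega>) \<partial>M)"
      by (rule arg_cong)
    also have "\<dots> = 1 + of_real \<theta> * (\<integral>\<omega>. ?g (xi k \<omega>) \<partial>M)"
      using E[OF _ g] by (simp add: prob_space)
    also have "(\<integral>\<omega>. ?g (xi k \<omega>) \<partial>M) = 1 / of_real R - 1"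
      using int_\<psi>[OF k] by (simp add: prob_space)
    finally show ?thesis by (simp add: \<rho>_def algebra_simps)
  qed
  let ?x = "\<lambda>k \<omega>. complex_of_real (chi k \<omega> * xi k \<omega>)"
  have int_x\<phi>: "integrable M (\<lambda>\<omega>. ?x k \<omega> * \<phi> k \<omega>)"
    and Ex\<phi>: "(\<integral>\<omega>. ?x k \<omega> * \<phi> k \<omega> \<partial>M)
        = \<i> * of_real (\<theta> * b * sgn (v k) * expectation (\<lambda>\<omega>. \<bar>xi k \<omega>\<bar>) / R)"
    if k: "k < n" for k
  proof -
    let ?g = "\<lambda>x. of_real x * (1 + \<i> * of_real (\<psi> k x)) / of_real R :: complex"
    have g: "?g \<in> borel_measurable borel" by measurable
    \<comment> \<open>Since \<open>xi k\<close> has mean zero, only the term with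
      \<open>\<bar>x\<bar>\<close> survives integration, and the expectation is purely
      imaginary.\<close>
    have g_eq: "?g x = (of_real x + \<i> * of_real (b * sgn (v k) * (\<bar>x\<bar> - m k * x))) / of_real R" for x
    proof -
      have "x * \<psi> k x = b * sgn (v k) * (\<bar>x\<bar> - m k * x)"
        by (simp add: \<psi>_def abs_sgn algebra_simps)
      then have "of_real (b * sgn (v k) * (\<bar>x\<bar> - m k * x)) = of_real x * (of_real (\<psi> k x) :: complex)"
        by (metis of_real_mult)
      then show ?thesis by (simp add: distrib_left mult_ac)
    qed
    have int_g: "integrable M (\<lambda>\<omega>. ?g (xi k \<omega>))"
      unfolding g_eq using int[OF k] by auto
    note E = expectation_bernoulli_mult[OF ind2[OF k] chi_01[OF k] \<theta>[OF k] g int_g]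
    have eq: "?x k \<omega> * \<phi> k \<omega> = of_real (chi k \<omega>) * ?g (xi k \<omega>)" if "\<omega> \<in> space M" for \<omega>
      using chi_01[OF k that] by (auto simp: \<phi>_def F_def)
    show "integrable M (\<lambda>\<omega>. ?x k \<omega> * \<phi> k \<omega>)"
      using E(1) by (subst Bochner_Integration.integrable_cong[OF refl eq]) auto
    have "(\<integral>\<omega>. ?x k \<omega> * \<phi> k \<omega> \<partial>M) = (\<integral>\<omega>. of_real (chi k \<omega>) * ?g (xi k \<omega>) \<partial>M)"
      by (intro Bochner_Integration.integral_cong refl eq)
    also have "\<dots> = of_real \<theta> * (\<integral>\<omega>. ?g (xi k \<omega>) \<partial>M)" by (rule E(2)) auto
    also have "(\<integral>\<omega>. ?g (xi k \<omega>) \<partial>M) = \<i> * of_real (b * sgn (v k) * expectation (\<lambda>\<omega>. \<bar>xi k \<omega>\<bar>)) / of_real R"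
      unfolding g_eq using int[OF k] mean[OF k] by (simp add: integral_complex_of_real)
    finally show "(\<integral>\<omega>. ?x k \<omega> * \<phi> k \<omega> \<partial>M)
        = \<i> * of_real (\<theta> * b * sgn (v k) * expectation (\<lambda>\<omega>. \<bar>xi k \<omega>\<bar>) / R)"
      by simp
  qed
  define P where "P \<omega> = (\<Prod>k<n. \<phi> k \<omega>)" for \<omega>
  have xP: "integrable M (\<lambda>\<omega>. ?x j \<omega> * P \<omega>)"
    "(\<integral>\<omega>. ?x j \<omega> * P \<omega> \<partial>M)
        = \<i> * of_real (\<theta> * b * sgn (v j) * expectation (\<lambda>\<omega>. \<bar>xi j \<omega>\<bar>) / R * \<rho> ^ (n - 1))"
    if j: "j < n" for j
  proof -
    \<comment> \<open>Only factor \<open>j\<close> carries the entry, so independence yields its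
      mean times \<open>n - 1\<close> copies of \<open>\<rho>\<close>.\<close>
    define Y where "Y k = (\<lambda>z. (if k = j then of_real (fst z * snd z) else 1) * F k z)" for k
    have Z: "indep_vars (\<lambda>_. borel) (\<lambda>k \<omega>. Y k (chi k \<omega>, xi k \<omega>)) {..<n}"
      by (rule indep_vars_compose2[OF ind]) (simp add: Y_def)
    have intY: "integrable M (\<lambda>\<omega>. Y k (chi k \<omega>, xi k \<omega>))" if "k \<in> {..<n}" for k
      using that int_x\<phi>[of k] int_phi[of k] by (cases "k = j") (simp_all add: Y_def \<phi>_def[abs_def])
    have eq: "(\<Prod>k<n. Y k (chi k \<omega>, xi k \<omega>)) = ?x j \<omega> * P \<omega>" for \<omega>
      using j unfolding Y_def P_def prod.distrib by (simp add: \<phi>_def)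
    show "integrable M (\<lambda>\<omega>. ?x j \<omega> * P \<omega>)"
      using indep_vars_integrable[OF _ Z intY] unfolding eq by auto
    have "(\<integral>\<omega>. ?x j \<omega> * P \<omega> \<partial>M) = (\<Prod>k<n. \<integral>\<omega>. Y k (chi k \<omega>, xi k \<omega>) \<partial>M)"
      using indep_vars_lebesgue_integral[OF _ Z intY] unfolding eq by auto
    also have "\<dots> = (\<integral>\<omega>. Y j (chi j \<omega>, xi j \<omega>) \<partial>M) * (\<Prod>k\<in>{..<n}-{j}. \<integral>\<omega>. Y k (chi k \<omega>, xi k \<omega>) \<partial>M)"
      using j by (intro prod.remove) auto
    also have "(\<Prod>k\<in>{..<n}-{j}. \<integral>\<omega>. Y k (chi k \<omega>, xi k \<omega>) \<partial>M) = (\<Prod>k\<in>{..<n}-{j}. of_real \<rho>)"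
    proof (intro prod.cong refl)
      fix k assume k: "k \<in> {..<n} - {j}"
      then have "(\<lambda>\<omega>. Y k (chi k \<omega>, xi k \<omega>)) = \<phi> k" by (auto simp: Y_def \<phi>_def)
      with E\<phi>[of k] k show "(\<integral>\<omega>. Y k (chi k \<omega>, xi k \<omega>) \<partial>M) = of_real \<rho>" by simp
    qed
    also have "\<dots> = of_real (\<rho> ^ (n - 1))" using j by simp
    also have "(\<integral>\<omega>. Y j (chi j \<omega>, xi j \<omega>) \<partial>M) = (\<integral>\<omega>. ?x j \<omega> * \<phi> j \<omega> \<partial>M)"
      by (simp add: Y_def \<phi>_def)
    finally show "(\<integral>\<omega>. ?x j \<omega> * P \<omega> \<partial>M)
        = \<i> * of_real (\<theta> * b * sgn (v j) * expectation (\<lambda>\<omega>. \<bar>xi j \<omega>\<bar>) / R * \<rho> ^ (n - 1))"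
      unfolding Ex\<phi>[OF j] by simp
  qed
  define S where "S \<omega> = (\<Sum>j<n. chi j \<omega> * xi j \<omega> * v j)" for \<omega>
  have SP: "of_real (S \<omega>) * P \<omega> = (\<Sum>j<n. (?x j \<omega> * P \<omega>) * of_real (v j))" for \<omega>
    unfolding S_def by (simp add: sum_distrib_right sum_distrib_left mult_ac)
  have intSP: "integrable M (\<lambda>\<omega>. of_real (S \<omega>) * P \<omega>)"
    unfolding SP by (intro Bochner_Integration.integrable_sum integrable_mult_left xP) auto
  have "(\<Sum>j<n. \<bar>v j\<bar> * (\<theta> * b * expectation (\<lambda>\<omega>. \<bar>xi j \<omega>\<bar>) / R * \<rho> ^ (n - 1)))
      = Im (\<integral>\<omega>. of_real (S \<omega>) * P \<omega> \<partial>M)"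
  proof -
    have "(\<integral>\<omega>. of_real (S \<omega>) * P \<omega> \<partial>M) = (\<Sum>j<n. (\<integral>\<omega>. ?x j \<omega> * P \<omega> \<partial>M) * of_real (v j))"
      unfolding SP using xP by (simp add: Bochner_Integration.integral_sum)
    also have "Im \<dots> = (\<Sum>j<n. \<bar>v j\<bar> * (\<theta> * b * expectation (\<lambda>\<omega>. \<bar>xi j \<omega>\<bar>) / R * \<rho> ^ (n - 1)))"
      unfolding Im_sum
    proof (intro sum.cong refl)
      fix j assume j: "j \<in> {..<n}"
      \<comment> \<open>The \<open>sgn (v j)\<close> built into \<open>\<psi>\<close> aligns all
        contributions, so that they add up to a multiple of the l1 norm when the absolute means
        agree.\<close>
      have "sgn (v j) * v j = \<bar>v j\<bar>" by (simp add: sgn_real_def)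
      moreover have "Im ((\<integral>\<omega>. ?x j \<omega> * P \<omega> \<partial>M) * of_real (v j))
          = (\<theta> * b * expectation (\<lambda>\<omega>. \<bar>xi j \<omega>\<bar>) / R * \<rho> ^ (n - 1)) * (sgn (v j) * v j)"
        using j by (subst xP(2)) (auto simp: mult_ac)
      ultimately show "Im ((\<integral>\<omega>. ?x j \<omega> * P \<omega> \<partial>M) * of_real (v j))
          = \<bar>v j\<bar> * (\<theta> * b * expectation (\<lambda>\<omega>. \<bar>xi j \<omega>\<bar>) / R * \<rho> ^ (n - 1))"
        by (simp add: mult.commute)
    qed
    finally show ?thesis ..
  qed
  also have "\<dots> = (\<integral>\<omega>. Im (of_real (S \<omega>) * P \<omega>) \<partial>M)"
    using integral_Im[OF intSP] by simp
  also have "\<dots> \<le> (\<integral>\<omega>. \<bar>S \<omega>\<bar> \<partial>M)"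
  proof (rule integral_mono)
    show "integrable M (\<lambda>\<omega>. Im (of_real (S \<omega>) * P \<omega>))" using intSP by (rule integrable_Im)
    have "integrable M (\<lambda>\<omega>. chi j \<omega> * xi j \<omega>)" if j: "j < n" for j
      using expectation_bernoulli_mult(1)[OF ind2[OF j] chi_01[OF j] \<theta>[OF j], of "\<lambda>x. x"] int[OF j] by auto
    then show "integrable M (\<lambda>\<omega>. \<bar>S \<omega>\<bar>)"
      unfolding S_def by (intro integrable_abs Bochner_Integration.integrable_sum integrable_mult_left) auto
    fix \<omega> assume \<omega>: "\<omega> \<in> space M"
    have "norm (P \<omega>) \<le> 1"
      unfolding P_def prod_norm[symmetric] using \<phi>_le \<omega> by (intro prod_le_1) auto
    have "Im (of_real (S \<omega>) * P \<omega>) \<le> norm (of_real (S \<omega>) * P \<omega>)"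
      using abs_Im_le_cmod abs_le_D1 by blast
    also have "\<dots> \<le> \<bar>S \<omega>\<bar> * 1" unfolding norm_mult norm_of_real using \<open>norm (P \<omega>) \<le> 1\<close> by (intro mult_left_mono) auto
    finally show "Im (of_real (S \<omega>) * P \<omega>) \<le> \<bar>S \<omega>\<bar>" by simp
  qed
  finally show ?thesis unfolding S_def .
qed

text \<open>For small \<open>b\<close> the Riesz bound has a gain of order
  \<open>\<theta> * b\<close> and a loss of about
  \<open>exp (- 2 * n * \<theta> * b\<^sup>2)\<close>. They balance at \<open>b\<close> of order
  \<open>1 / sqrt (n * \<theta>)\<close>, where the gain is of order
  \<open>sqrt (\<theta> / n)\<close>. The choice is \<open>b = d / 2\<close>, and
  \<open>1 / n \<le> \<theta>\<close> gives \<open>d \<le> 1\<close>.\<close>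

lemma (in prob_space) expectation_abs_sum_ge:
  fixes chi xi :: "nat \<Rightarrow> 'a \<Rightarrow> real"
  assumes ind: "indep_vars (\<lambda>_. borel \<Otimes>\<^sub>M borel) (\<lambda>k \<omega>. (chi k \<omega>, xi k \<omega>)) {..<n}"
    and ind2: "\<And>k. k < n \<Longrightarrow> indep_var borel (chi k) borel (xi k)"
    and chi_01: "\<And>k \<omega>. k < n \<Longrightarrow> \<omega> \<in> space M \<Longrightarrow> chi k \<omega> \<in> {0, 1}"
    and \<theta>: "\<And>k. k < n \<Longrightarrow> prob {\<omega> \<in> space M. chi k \<omega> = 1} = \<theta>"
    and int: "\<And>k. k < n \<Longrightarrow> integrable M (xi k)"
    and mean: "\<And>k. k < n \<Longrightarrow> expectation (xi k) = 0"
    and abs: "\<And>k. k < n \<Longrightarrow> 1 / 10 \<le> expectation (\<lambda>\<omega>. \<bar>xi k \<omega>\<bar>)"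
    and n: "0 < n" and \<theta>0: "1 / real n \<le> \<theta>" "\<theta> \<le> 1"
  shows "sqrt (\<theta> / n) / 80 * (\<Sum>j<n. \<bar>v j\<bar>) \<le> expectation (\<lambda>\<omega>. \<bar>\<Sum>j<n. chi j \<omega> * xi j \<omega> * v j\<bar>)"
proof -
  have \<theta>pos: "\<theta> > 0" using \<theta>0 n by (meson divide_pos_pos less_le_trans of_nat_0_less_iff zero_less_one)
  define d where "d = 1 / sqrt (n * \<theta>)"
  have d0: "d > 0" using n \<theta>pos by (simp add: d_def)
  have n\<theta>: "1 \<le> n * \<theta>" using \<theta>0 n by (simp add: field_simps)
  have d2: "d\<^sup>2 = 1 / (n * \<theta>)" using n\<theta> by (simp add: d_def power_divide)
  have d1: "d\<^sup>2 \<le> 1" unfolding d2 using n\<theta> by simp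
  define R where "R = sqrt (1 + 4 * (d / 2)\<^sup>2)"
  have R: "R = sqrt (1 + d\<^sup>2)" by (simp add: R_def power_divide)
  have R1: "R \<ge> 1" unfolding R by simp
  have Rle: "R \<le> 1 + d\<^sup>2 / 2"
    unfolding R using d0 by (intro real_le_lsqrt) (auto simp: power2_eq_square algebra_simps)
  have R2: "R \<le> 2" using Rle d1 by simp
  have "0 \<le> (R - 1)\<^sup>2" by simp
  \<comment> \<open>The tangent of \<open>1 / R\<close> at \<open>R = 1\<close>.\<close>
  then have "2 - R \<le> 1 / R" using R1 by (simp add: field_simps power2_eq_square)
  then have Rinv: "1 - d\<^sup>2 / 2 \<le> 1 / R" using Rle by linarith
  define \<rho> where "\<rho> = 1 - \<theta> + \<theta> / R"
  have "\<theta> * (1 - d\<^sup>2 / 2) \<le> \<theta> * (1 / R)" using Rinv \<theta>pos by (intro mult_left_mono) auto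
  moreover have "\<theta> * d\<^sup>2 = 1 / n" unfolding d2 using \<theta>pos by simp
  ultimately have \<rho>: "\<rho> \<ge> 1 - 1 / (2 * n)" unfolding \<rho>_def by (simp add: algebra_simps)
  have "1 / 2 \<le> 1 + real (n - 1) * (- (1 / (2 * n)))"
    using n by (simp add: field_simps)
  also have "\<dots> \<le> (1 + - (1 / (2 * n))) ^ (n - 1)"
    using n by (intro Bernoulli_inequality) (simp add: field_simps)
  also have "\<dots> \<le> \<rho> ^ (n - 1)" using \<rho> n by (intro power_mono) (auto simp: field_simps)
  finally have \<rho>n: "1 / 2 \<le> \<rho> ^ (n - 1)" .
  have \<theta>d: "\<theta> * d = sqrt (\<theta> / n)"
    unfolding d_def using \<theta>pos n by (simp add: real_sqrt_mult real_sqrt_divide field_simps)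
  \<comment> \<open>\<open>80 = 2 * 10 * 2 * 2\<close>, from \<open>b = d / 2\<close>, the lower
    bound on the mean of \<open>\<bar>xi j\<bar>\<close>, \<open>R \<le> 2\<close> and
    \<open>\<rho> ^ (n - 1) \<ge> 1 / 2\<close>.\<close>
  have "sqrt (\<theta> / n) / 80 * (\<Sum>j<n. \<bar>v j\<bar>) = (\<Sum>j<n. \<bar>v j\<bar> * (\<theta> * (d / 2) * (1 / 10) / 2 * (1 / 2)))"
    by (simp add: \<theta>d[symmetric] sum_distrib_left mult_ac)
  also have "\<dots> \<le> (\<Sum>j<n. \<bar>v j\<bar> * (\<theta> * (d / 2) * expectation (\<lambda>\<omega>. \<bar>xi j \<omega>\<bar>) / R * \<rho> ^ (n - 1)))"
    using abs \<theta>pos d0 R1 R2 \<rho>n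
    by (intro sum_mono mult_left_mono mult_mono frac_le) (auto intro!: mult_nonneg_nonneg divide_nonneg_nonneg)
  also have "\<dots> \<le> expectation (\<lambda>\<omega>. \<bar>\<Sum>j<n. chi j \<omega> * xi j \<omega> * v j\<bar>)"
    unfolding R_def \<rho>_def
    by (rule riesz_product_lower_bound) (use assms d0 in auto)
  finally show ?thesis .
qed

section \<open>Exponential moments of the entries\<close>

text \<open>The sum of the geometric series \<open>2 * exp 7 * exp (-1) ^ k\<close>, which dominates
  the mean of \<open>exp (2 * \<bar>xi\<bar>)\<close> level by level.\<close>

definition mgf_bound :: real where "mgf_bound = 2 * exp 7 / (1 - exp (-1))"

lemma mgf_bound_pos: "mgf_bound > 0"
  by (simp add: mgf_bound_def)

text \<open>Slicing at integer levels: where \<open>\<bar>xi\<bar>\<close> lies between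
  \<open>k\<close> and \<open>k + 1\<close> the exponential is at most
  \<open>exp (2 * (k + 1))\<close>, and the Gaussian tail beats this growth. The rate
  \<open>2\<close> is the one that \<open>cosh_le_square\<close> consumes.\<close>

lemma (in prob_space) subgaussian_exp_moment:
  assumes [measurable]: "xi \<in> borel_measurable M"
    and tail: "\<And>t. t > 0 \<Longrightarrow> prob {\<omega> \<in> space M. \<bar>xi \<omega>\<bar> \<ge> t} \<le> 2 * exp (- t\<^sup>2 / 2)"
  shows "integrable M (\<lambda>\<omega>. exp (2 * \<bar>xi \<omega>\<bar>))" (is ?int)
    and "expectation (\<lambda>\<omega>. exp (2 * \<bar>xi \<omega>\<bar>)) \<le> mgf_bound" (is ?le)
proof -
  define A where "A k = {\<omega> \<in> space M. \<bar>xi \<omega>\<bar> \<ge> real k}" for k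
  have [measurable]: "A k \<in> sets M" for k unfolding A_def by measurable
  have A_le: "exp (2 * (real k + 1)) * prob (A k) \<le> 2 * exp 7 * exp (-1) ^ k" for k
  \<comment> \<open>The tail hypothesis covers only \<open>t > 0\<close>, so level \<open>0\<close>
    relies on probabilities being at most \<open>1\<close>.\<close>
  proof (cases "k = 0")
    case True
    have "exp (2::real) * prob (A 0) \<le> exp 7 * 2" by (intro mult_mono) (auto intro: order_trans[OF prob_le_1])
    then show ?thesis using True by (simp add: mult.commute)
  next
    case False
    then have "exp (2 * (real k + 1)) * prob (A k) \<le> exp (2 * (real k + 1)) * (2 * exp (- (real k)\<^sup>2 / 2))"
      unfolding A_def by (intro mult_left_mono tail) auto
    also have "\<dots> = 2 * exp (2 * (real k + 1) + - (real k)\<^sup>2 / 2)"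
      by (simp only: exp_add mult_ac)
    \<comment> \<open>Completing the square: the exponents differ by
      \<open>(k - 3)\<^sup>2 / 2 + 1 / 2\<close>.\<close>
    also have "\<dots> \<le> 2 * exp (7 + real k * (-1))"
    proof -
      have "0 \<le> (real k - 3)\<^sup>2" by simp
      then show ?thesis by (simp add: power2_eq_square algebra_simps)
    qed
    also have "\<dots> = 2 * exp 7 * exp (-1) ^ k"
      unfolding exp_add exp_of_nat_mult by simp
    finally show ?thesis .
  qed
  have sums: "(\<lambda>k. 2 * exp 7 * exp (-1) ^ k) sums mgf_bound"
    using sums_mult[OF geometric_sums[of "exp (-1 :: real)"], of "2 * exp 7"] by (simp add: mgf_bound_def)
  have "(\<integral>\<^sup>+\<omega>. ennreal (exp (2 * \<bar>xi \<omega>\<bar>)) \<partial>M)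
      \<le> (\<integral>\<^sup>+\<omega>. (\<Sum>k. ennreal (exp (2 * (real k + 1))) * indicator (A k) \<omega>) \<partial>M)"
  proof (intro nn_integral_mono)
    fix \<omega> assume \<omega>: "\<omega> \<in> space M"
    define k where "k = nat \<lfloor>\<bar>xi \<omega>\<bar>\<rfloor>"
    have k: "real k \<le> \<bar>xi \<omega>\<bar>" "\<bar>xi \<omega>\<bar> \<le> real k + 1"
      unfolding k_def by linarith+
    have "ennreal (exp (2 * \<bar>xi \<omega>\<bar>)) \<le> ennreal (exp (2 * (real k + 1))) * indicator (A k) \<omega>"
      using k \<omega> by (auto simp: A_def intro!: ennreal_leI)
    also have "\<dots> \<le> (\<Sum>k. ennreal (exp (2 * (real k + 1))) * indicator (A k) \<omega>)"
      using sum_le_suminf[of "\<lambda>k. ennreal (exp (2 * (real k + 1))) * indicator (A k) \<omega>" "{k}"]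
      by (simp only: sum.insert_remove finite.intros) simp
    finally show "ennreal (exp (2 * \<bar>xi \<omega>\<bar>)) \<le> \<dots>" .
  qed
  also have "\<dots> = (\<Sum>k. \<integral>\<^sup>+\<omega>. ennreal (exp (2 * (real k + 1))) * indicator (A k) \<omega> \<partial>M)"
    by (intro nn_integral_suminf) measurable
  also have "\<dots> = (\<Sum>k. ennreal (exp (2 * (real k + 1)) * prob (A k)))"
    by (simp add: nn_integral_cmult emeasure_eq_measure ennreal_mult)
  also have "\<dots> \<le> (\<Sum>k. ennreal (2 * exp 7 * exp (-1) ^ k))"
    by (intro suminf_le ennreal_leI A_le) auto
  also have "\<dots> = ennreal mgf_bound"
    using sums by (intro suminf_ennreal_eq) auto
  finally have le: "(\<integral>\<^sup>+\<omega>. ennreal (exp (2 * \<bar>xi \<omega>\<bar>)) \<partial>M) \<le> ennreal mgf_bound" .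
  show ?int
    by (rule integrableI_bounded) (use le in \<open>auto simp: le_less_trans\<close>)
  show ?le
    using le mgf_bound_pos by (subst integral_eq_nn_integral) (auto intro!: enn2real_leI)
qed

text \<open>The linear Taylor terms cancel in \<open>cosh\<close>, which leaves
  \<open>m\<^sup>2\<close>. Of the two factors \<open>exp \<bar>y\<bar>\<close>, one absorbs
  \<open>y\<^sup>2 / 2\<close> and the other the Taylor remainder, as
  \<open>m \<le> 1\<close>.\<close>

lemma cosh_le_square:
  fixes m y :: real
  assumes "0 \<le> m" "m \<le> 1"
  shows "cosh (m * y) \<le> 1 + m\<^sup>2 * exp (2 * \<bar>y\<bar>)"
proof -
  define z where "z = m * \<bar>y\<bar>"
  have e: "exp w \<le> 1 + w + w\<^sup>2 / 2 * exp \<bar>w\<bar>" for w :: real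
  proof -
    obtain t where t: "\<bar>t\<bar> \<le> \<bar>w\<bar>" "exp w = (\<Sum>k<2. w ^ k / fact k) + exp t / fact 2 * w ^ 2"
      using Maclaurin_exp_le[of w 2] by blast
    have "exp t * w\<^sup>2 \<le> exp \<bar>w\<bar> * w\<^sup>2" using t(1) by (intro mult_right_mono) auto
    with t(2) show ?thesis by (simp add: numeral_2_eq_2 mult.commute)
  qed
  have z: "0 \<le> z" "z \<le> \<bar>y\<bar>" unfolding z_def using assms by (auto simp: mult_left_le_one_le)
  have "cosh (m * y) = cosh z"
    unfolding z_def by (cases "y \<ge> 0") auto
  also have "\<dots> \<le> 1 + z\<^sup>2 / 2 * exp z"
    using e[of z] e[of "-z"] z(1) by (simp add: cosh_def)
  also have "\<dots> \<le> 1 + m\<^sup>2 * (exp \<bar>y\<bar> * exp \<bar>y\<bar>)"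
  proof -
    have "\<bar>y\<bar>\<^sup>2 / 2 \<le> exp \<bar>y\<bar>" using exp_lower_Taylor_quadratic[of "\<bar>y\<bar>"] by simp
    then have "m\<^sup>2 * (\<bar>y\<bar>\<^sup>2 / 2 * exp z) \<le> m\<^sup>2 * (exp \<bar>y\<bar> * exp \<bar>y\<bar>)"
      using z by (intro mult_left_mono mult_mono) auto
    then show ?thesis unfolding z_def by (simp add: power_mult_distrib mult_ac)
  qed
  also have "exp \<bar>y\<bar> * exp \<bar>y\<bar> = exp (2 * \<bar>y\<bar>)" by (simp add: exp_add[symmetric])
  finally show ?thesis .
qed

text \<open>Where \<open>chi\<close> vanishes the \<open>cosh\<close> equals \<open>1\<close>, so
  its excess over \<open>1\<close> carries a factor \<open>chi\<close>, whose mean supplies the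
  \<open>\<theta>\<close>.\<close>

lemma (in prob_space) cosh_moment:
  assumes ind: "indep_var borel chi borel xi"
    and chi_01: "\<And>\<omega>. \<omega> \<in> space M \<Longrightarrow> chi \<omega> \<in> {0, 1}"
    and \<theta>: "prob {\<omega> \<in> space M. chi \<omega> = 1} = \<theta>"
    and tail: "\<And>t. t > 0 \<Longrightarrow> prob {\<omega> \<in> space M. \<bar>xi \<omega>\<bar> \<ge> t} \<le> 2 * exp (- t\<^sup>2 / 2)"
    and m: "0 \<le> m" "m \<le> 1"
  shows "integrable M (\<lambda>\<omega>. cosh (m * (chi \<omega> * xi \<omega>)))" (is ?int)
    and "expectation (\<lambda>\<omega>. cosh (m * (chi \<omega> * xi \<omega>))) \<le> 1 + m\<^sup>2 * \<theta> * mgf_bound" (is ?le)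
proof -
  have [measurable]: "chi \<in> borel_measurable M" "xi \<in> borel_measurable M"
    using ind by (auto dest: indep_var_rv1 indep_var_rv2)
  note ex = subgaussian_exp_moment[OF _ tail]
  have b: "integrable M (\<lambda>\<omega>. chi \<omega> * exp (2 * \<bar>xi \<omega>\<bar>))"
    "expectation (\<lambda>\<omega>. chi \<omega> * exp (2 * \<bar>xi \<omega>\<bar>)) = \<theta> * expectation (\<lambda>\<omega>. exp (2 * \<bar>xi \<omega>\<bar>))"
    using expectation_bernoulli_mult[OF ind chi_01 \<theta>, of "\<lambda>x. exp (2 * \<bar>x\<bar>)"] ex(1) by auto
  have pw: "cosh (m * (chi \<omega> * xi \<omega>)) \<le> 1 + m\<^sup>2 * (chi \<omega> * exp (2 * \<bar>xi \<omega>\<bar>))" if "\<omega> \<in> space M" for \<omega>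
    using chi_01[OF that] cosh_le_square[OF m, of "xi \<omega>"] by auto
  have bi: "integrable M (\<lambda>\<omega>. 1 + m\<^sup>2 * (chi \<omega> * exp (2 * \<bar>xi \<omega>\<bar>)))" using b(1) by auto
  show ?int
  proof (rule Bochner_Integration.integrable_bound[OF bi])
    show "(\<lambda>\<omega>. cosh (m * (chi \<omega> * xi \<omega>))) \<in> borel_measurable M" unfolding cosh_def by measurable
    show "AE \<omega> in M. norm (cosh (m * (chi \<omega> * xi \<omega>))) \<le> norm (1 + m\<^sup>2 * (chi \<omega> * exp (2 * \<bar>xi \<omega>\<bar>)))"
    proof (intro AE_I2)
      fix \<omega> assume "\<omega> \<in> space M"
      from pw[OF this] show "norm (cosh (m * (chi \<omega> * xi \<omega>))) \<le> norm (1 + m\<^sup>2 * (chi \<omega> * exp (2 * \<bar>xi \<omega>\<bar>)))"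
        by simp
    qed
  qed
  then have "expectation (\<lambda>\<omega>. cosh (m * (chi \<omega> * xi \<omega>))) \<le> expectation (\<lambda>\<omega>. 1 + m\<^sup>2 * (chi \<omega> * exp (2 * \<bar>xi \<omega>\<bar>)))"
    by (intro integral_mono bi pw)
  also have "\<dots> = 1 + m\<^sup>2 * (\<theta> * expectation (\<lambda>\<omega>. exp (2 * \<bar>xi \<omega>\<bar>)))"
    using b by (simp add: prob_space)
  also have "\<dots> \<le> 1 + m\<^sup>2 * (\<theta> * mgf_bound)"
    using ex(2) \<theta> by (intro add_left_mono mult_left_mono) auto
  finally show ?le by (simp add: mult.assoc)
qed

section \<open>Uniform deviation\<close>

lemma l1_XTv_eq_lin:
  "l1_XTv n p X v \<omega> = (\<Sum>j<p. \<bar>lin n v (\<lambda>i\<in>{..<n}. X i j \<omega>)\<bar>)"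
  by (simp add: l1_XTv_def lin_def)

text \<open>The joint independence is regrouped along disjoint index blocks. The first two forms
  serve the Riesz product and the moments of one entry; the third makes the law of the matrix a
  product over its columns.\<close>

lemma bern_subgauss_indep:
  assumes "bern_subgauss M n p \<theta> chi xi"
  shows "j < p \<Longrightarrow> prob_space.indep_vars M (\<lambda>_. borel \<Otimes>\<^sub>M borel) (\<lambda>i \<omega>. (chi i j \<omega>, xi i j \<omega>)) {..<n}"
    and "i < n \<Longrightarrow> j < p \<Longrightarrow> prob_space.indep_var M borel (chi i j) borel (xi i j)"
    and "prob_space.indep_vars M (\<lambda>_. PiM {..<n} (\<lambda>_. borel))
          (\<lambda>j \<omega>. \<lambda>i\<in>{..<n}. chi i j \<omega> * xi i j \<omega>) {..<p}"
proof -
  interpret prob_space M using assms by (simp add: bern_subgauss_def)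
  let ?I = "Inl ` ({..<n} \<times> {..<p}) \<union> Inr ` ({..<n} \<times> {..<p}) :: (nat \<times> nat + nat \<times> nat) set"
  define Z where "Z = (\<lambda>k. case k of Inl (i, j) \<Rightarrow> chi i j | Inr (i, j) \<Rightarrow> xi i j)"
  have Z: "indep_vars (\<lambda>_. borel) Z ?I"
    using assms by (simp add: bern_subgauss_def Z_def)
  have Z_simps: "Z (Inl (i, j)) = chi i j" "Z (Inr (i, j)) = xi i j" for i j
    by (simp_all add: Z_def)
  show "indep_vars (\<lambda>_. borel \<Otimes>\<^sub>M borel) (\<lambda>i \<omega>. (chi i j \<omega>, xi i j \<omega>)) {..<n}" if j: "j < p"
  proof -
    define K where "K i = {Inl (i, j), Inr (i, j)}" for i :: nat
    define Y where "Y i f = (f (Inl (i, j)), f (Inr (i, j)))" for i and f :: "nat \<times> nat + nat \<times> nat \<Rightarrow> real"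
    have "indep_vars (\<lambda>i. PiM (K i) (\<lambda>_. borel)) (\<lambda>i \<omega>. restrict (\<lambda>k. Z k \<omega>) (K i)) {..<n}"
      by (rule indep_vars_restrict[OF Z]) (use j in \<open>auto simp: K_def disjoint_family_on_def\<close>)
    moreover have "Y i \<in> PiM (K i) (\<lambda>_. borel) \<rightarrow>\<^sub>M borel \<Otimes>\<^sub>M borel" for i
      unfolding Y_def K_def by measurable
    ultimately have "indep_vars (\<lambda>_. borel \<Otimes>\<^sub>M borel) (\<lambda>i \<omega>. Y i (restrict (\<lambda>k. Z k \<omega>) (K i))) {..<n}"
      by (rule indep_vars_compose2)
    then show ?thesis by (simp add: Y_def K_def Z_simps)
  qed
  show "indep_var borel (chi i j) borel (xi i j)" if ij: "i < n" "j < p"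
  proof -
    have "indep_var (PiM {Inl (i, j)} (\<lambda>_. borel)) (\<lambda>\<omega>. restrict (\<lambda>k. Z k \<omega>) {Inl (i, j)})
       (PiM {Inr (i, j)} (\<lambda>_. borel)) (\<lambda>\<omega>. restrict (\<lambda>k. Z k \<omega>) {Inr (i, j)})"
      by (rule indep_var_restrict[OF Z]) (use ij in auto)
    then have "indep_var borel ((\<lambda>f. f (Inl (i, j))) \<circ> (\<lambda>\<omega>. restrict (\<lambda>k. Z k \<omega>) {Inl (i, j)}))
       borel ((\<lambda>f. f (Inr (i, j))) \<circ> (\<lambda>\<omega>. restrict (\<lambda>k. Z k \<omega>) {Inr (i, j)}))"
      by (rule indep_var_compose) measurable
    then show ?thesis by (simp add: comp_def Z_simps)
  qed
  show "indep_vars (\<lambda>_. PiM {..<n} (\<lambda>_. borel)) (\<lambda>j \<omega>. \<lambda>i\<in>{..<n}. chi i j \<omega> * xi i j \<omega>) {..<p}"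
  proof -
    define K where "K j = Inl ` ({..<n} \<times> {j}) \<union> Inr ` ({..<n} \<times> {j})" for j :: nat
    define Y where "Y j f = (\<lambda>i\<in>{..<n}. f (Inl (i, j)) * f (Inr (i, j)))"
      for j and f :: "nat \<times> nat + nat \<times> nat \<Rightarrow> real"
    have "indep_vars (\<lambda>j. PiM (K j) (\<lambda>_. borel)) (\<lambda>j \<omega>. restrict (\<lambda>k. Z k \<omega>) (K j)) {..<p}"
      by (rule indep_vars_restrict[OF Z]) (auto simp: K_def disjoint_family_on_def)
    moreover have "Y j \<in> PiM (K j) (\<lambda>_. borel) \<rightarrow>\<^sub>M PiM {..<n} (\<lambda>_. borel)" for j
      unfolding Y_def by (intro measurable_restrict borel_measurable_times measurable_component_singleton)
        (auto simp: K_def)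
    ultimately have "indep_vars (\<lambda>_. PiM {..<n} (\<lambda>_. borel)) (\<lambda>j \<omega>. Y j (restrict (\<lambda>k. Z k \<omega>) (K j))) {..<p}"
      by (rule indep_vars_compose2)
    moreover have "Y j (restrict (\<lambda>k. Z k \<omega>) (K j)) = (\<lambda>i\<in>{..<n}. chi i j \<omega> * xi i j \<omega>)" for j \<omega>
      by (auto simp: Y_def K_def Z_simps restrict_def fun_eq_iff)
    ultimately show ?thesis by simp
  qed
qed

lemma bern_subgauss_entry_integrable:
  assumes X: "bern_subgauss M n p \<theta> chi xi" and ij: "i < n" "j < p"
  shows "integrable M (\<lambda>\<omega>. chi i j \<omega> * xi i j \<omega>)"
proof -
  interpret prob_space M using X by (simp add: bern_subgauss_def)
  show ?thesis
    using expectation_bernoulli_mult(1)[OF bern_subgauss_indep(2)[OF X ij], of \<theta> "\<lambda>x. x"] X ij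
    unfolding bern_subgauss_def by auto
qed

text \<open>For finite \<open>V\<close> the supremum is an integrable maximum. Each sign of the
  deviation has its own maximum, nonnegative because the zero vector lies in \<open>V\<close>, so
  Markov's inequality applies to both. The bound is independent of \<open>V\<close>.\<close>

lemma deviation_finite:
  fixes chi xi :: "nat \<Rightarrow> nat \<Rightarrow> 'a \<Rightarrow> real"
  assumes X: "bern_subgauss M n p \<theta> chi xi" and n: "0 < n" and p\<theta>: "1 \<le> p * \<theta>"
    and V: "finite V" "(\<lambda>_. 0) \<in> V" "\<And>v. v \<in> V \<Longrightarrow> (\<Sum>i<n. \<bar>v i\<bar>) \<le> 1" and \<tau>: "\<tau> > 0"
  defines "L \<equiv> l1_XTv n p (\<lambda>i j \<omega>. chi i j \<omega> * xi i j \<omega>)"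
  shows "measure M {\<omega> \<in> space M. \<exists>v\<in>V. \<tau> \<le> \<bar>L v \<omega> - integral\<^sup>L M (L v)\<bar>}
      \<le> 4 * sqrt (p * \<theta>) * (ln (2 * real n) + mgf_bound) / \<tau>"
proof -
  interpret prob_space M using X by (simp add: bern_subgauss_def)
  have p: "0 < p" using p\<theta> by (cases "p = 0") auto
  have \<theta>: "0 < \<theta>" "\<theta> \<le> 1" using X by (auto simp: bern_subgauss_def)
  define N :: "(nat \<Rightarrow> real) measure" where "N = PiM {..<n} (\<lambda>_. borel)"
  define col where "col j \<omega> = (\<lambda>i\<in>{..<n}. chi i j \<omega> * xi i j \<omega>)" for j \<omega>
  have ind: "indep_vars (\<lambda>_. N) col {..<p}"
    using bern_subgauss_indep(3)[OF X] unfolding N_def col_def .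
  have col_meas[measurable]: "col j \<in> M \<rightarrow>\<^sub>M N" if "j < p" for j
    using ind that unfolding indep_vars_def by auto
  \<comment> \<open>the index is truncated so that all \<open>D j\<close> are probability measures\<close>
  define D where "D j = distr M N (col (min j (p - 1)))" for j
  have j': "min j (p - 1) < p" for j using p by auto
  have D: "prob_space (D j)" for j
    unfolding D_def by (rule prob_space_distr) (use col_meas[OF j'] in simp)
  have distr: "distr M (PiM {..<p} (\<lambda>_. N)) (\<lambda>\<omega>. \<lambda>j\<in>{..<p}. col j \<omega>) = PiM {..<p} D"
  proof -
    have "distr M (PiM {..<p} (\<lambda>_. N)) (\<lambda>\<omega>. \<lambda>j\<in>{..<p}. col j \<omega>) = PiM {..<p} (\<lambda>j. distr M N (col j))"
      using ind p col_meas by (subst (asm) indep_vars_iff_distr_eq_PiM') auto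
    also have "\<dots> = PiM {..<p} D"
    proof (intro PiM_cong refl)
      fix j assume "j \<in> {..<p}"
      then have "min j (p - 1) = j" by auto
      then show "distr M N (col j) = D j" unfolding D_def by simp
    qed
    finally show ?thesis .
  qed
  have coord_meas: "(\<lambda>x. x i) \<in> borel_measurable N" if "i < n" for i
    unfolding N_def using that by (intro measurable_component_singleton) auto
  have lin_meas[measurable]: "lin n v \<in> borel_measurable N" for v
    unfolding lin_def by (intro borel_measurable_sum borel_measurable_times coord_meas) auto
  have D_integrable: "integrable (D j) f \<longleftrightarrow> integrable M (\<lambda>\<omega>. f (col (min j (p - 1)) \<omega>))"
    and D_integral: "integral\<^sup>L (D j) f = expectation (\<lambda>\<omega>. f (col (min j (p - 1)) \<omega>))"
    if "f \<in> borel_measurable N" for f :: "_ \<Rightarrow> real" and j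
    unfolding D_def using that col_meas[OF j'] by (auto simp: integrable_distr_eq integral_distr)
  \<comment> \<open>At this scale a column multiplies the potential by at most
    \<open>1 + mgf_bound / p\<close>, hence all \<open>p\<close> columns by at most
    \<open>exp mgf_bound\<close>. The assumption \<open>1 \<le> p * \<theta>\<close> gives the
    \<open>m \<le> 1\<close> that \<open>cosh_moment\<close> requires.\<close>
  define m where "m = 1 / sqrt (p * \<theta>)"
  have m: "0 < m" "m \<le> 1" unfolding m_def using p\<theta> by auto
  have m2: "m\<^sup>2 * \<theta> = 1 / p" unfolding m_def using p\<theta> \<theta> by (simp add: power_divide)
  define K where "K = 1 + mgf_bound / p"
  have cosh_meas: "(\<lambda>x. cosh (m * x i)) \<in> borel_measurable N" if "i < n" for i
    using coord_meas[OF that] by (simp add: cosh_def)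
  have cm: "integrable M (\<lambda>\<omega>. cosh (m * (chi i j \<omega> * xi i j \<omega>)))"
    "expectation (\<lambda>\<omega>. cosh (m * (chi i j \<omega> * xi i j \<omega>))) \<le> K" if ij: "i < n" "j < p" for i j
  proof -
    have "m\<^sup>2 * \<theta> * mgf_bound = mgf_bound / p" unfolding m2 by simp
    then show "integrable M (\<lambda>\<omega>. cosh (m * (chi i j \<omega> * xi i j \<omega>)))"
      "expectation (\<lambda>\<omega>. cosh (m * (chi i j \<omega> * xi i j \<omega>))) \<le> K"
      using cosh_moment[OF bern_subgauss_indep(2)[OF X ij], of \<theta> m] X ij m
      unfolding bern_subgauss_def K_def by auto
  qed
  \<comment> \<open>The tangent point is an upper bound for twice the final potential, which starts
    at \<open>n\<close>: the quotient is then at most \<open>1\<close>, cancels the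
    \<open>- 1\<close>, and leaves \<open>ln t\<close>.\<close>
  define t where "t = 2 * n * exp mgf_bound"
  have t: "t > 0" using n by (simp add: t_def)
  define B where "B = 2 * sqrt (p * \<theta>) * (ln (2 * real n) + mgf_bound)"
  define Z where "Z s X = Max ((\<lambda>v. 2 * lin n v (\<lambda>_. 0)
      + s * (\<Sum>j<p. \<bar>lin n v (X j)\<bar> - (\<integral>y. \<bar>lin n v y\<bar> \<partial>D j))) ` V)" for s and X :: "nat \<Rightarrow> nat \<Rightarrow> real"
  have Z_bound: "(\<integral>X. Z s X \<partial>PiM {..<p} D) \<le> B" if s: "s \<in> {1, -1}" for s
  proof -
    have "(\<integral>X. Z s X \<partial>PiM {..<p} D)
      \<le> 2 / m * (2 * K ^ card {..<p} * (\<Sum>i<n. cosh (m * 0)) / t + ln t - 1)"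
      unfolding Z_def
    proof (rule expectation_Max_le)
      fix i j assume i: "i < n"
      show "integrable (D j) (\<lambda>x. x i)"
        using D_integrable[OF coord_meas[OF i]] bern_subgauss_entry_integrable[OF X i j'] i
        by (simp add: col_def)
      show "integrable (D j) (\<lambda>x. cosh (m * x i))" "(\<integral>x. cosh (m * x i) \<partial>D j) \<le> K"
        using D_integrable[OF cosh_meas[OF i]] D_integral[OF cosh_meas[OF i]] cm[OF i j'] i
        by (simp_all add: col_def)
    qed (use D n m t V s mgf_bound_pos in \<open>auto simp: K_def\<close>)
    also have "\<dots> = 2 / m * (K ^ p * (2 * n) / t + ln t - 1)" by simp
    also have "\<dots> \<le> 2 / m * (1 + ln t - 1)"
    proof -
      have "K ^ p \<le> exp (mgf_bound / p) ^ p"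
        using mgf_bound_pos unfolding K_def by (intro power_mono exp_ge_add_one_self) auto
      also have "\<dots> = exp mgf_bound" using p by (simp add: exp_of_nat_mult[symmetric])
      finally have "K ^ p * (2 * n) \<le> t" unfolding t_def by (simp add: mult_ac mult_left_mono)
      then have "K ^ p * (2 * n) / t \<le> 1" using t by simp
      then show ?thesis using m by (intro mult_left_mono diff_right_mono add_right_mono) auto
    qed
    also have "\<dots> = B"
      unfolding B_def m_def t_def using n by (simp add: ln_mult)
    finally show ?thesis .
  qed
  define W where "W s \<omega> = Max ((\<lambda>v. s * (L v \<omega> - expectation (L v))) ` V)" for s \<omega>
  have lin_int: "integrable M (\<lambda>\<omega>. \<bar>lin n v (col j \<omega>)\<bar>)" if "j < p" for v j
    unfolding lin_def col_def using that
    by (auto intro!: Bochner_Integration.integrable_sum bern_subgauss_entry_integrable[OF X])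
  have L_eq: "L v \<omega> = (\<Sum>j<p. \<bar>lin n v (col j \<omega>)\<bar>)" for v \<omega>
    unfolding L_def l1_XTv_eq_lin col_def ..
  have L_int: "integrable M (L v)" for v
    unfolding L_eq[abs_def] using lin_int by (intro Bochner_Integration.integrable_sum) auto
  then have L_meas[measurable]: "L v \<in> borel_measurable M" for v by (rule borel_measurable_integrable)
  have EL: "expectation (L v) = (\<Sum>j<p. (\<integral>y. \<bar>lin n v y\<bar> \<partial>D j))" for v
  proof -
    have "(\<integral>y. \<bar>lin n v y\<bar> \<partial>D j) = expectation (\<lambda>\<omega>. \<bar>lin n v (col j \<omega>)\<bar>)" if "j < p" for j
    proof -
      have "min j (p - 1) = j" using that by auto
      then show ?thesis by (subst D_integral) auto
    qed
    then show ?thesis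
      unfolding L_eq[abs_def] using lin_int by (subst Bochner_Integration.integral_sum) auto
  qed
  have WZ: "W s \<omega> = Z s (\<lambda>j\<in>{..<p}. col j \<omega>)" for s \<omega>
    unfolding W_def Z_def EL L_eq by (simp add: lin_def sum_subtractf)
  have Z_meas: "Z s \<in> borel_measurable (PiM {..<p} (\<lambda>_. N))" for s
  proof -
    have "(\<lambda>X. lin n v (X j)) \<in> borel_measurable (PiM {..<p} (\<lambda>_. N))" if "j < p" for v j
      by (rule measurable_compose[OF _ lin_meas])
        (use that in \<open>auto intro!: measurable_component_singleton\<close>)
    then show ?thesis unfolding Z_def using V(1) by (intro borel_measurable_Max) auto
  qed
  have W_le: "expectation (W s) \<le> B" if "s \<in> {1, -1}" for s
  proof -
    have "(\<lambda>\<omega>. \<lambda>j\<in>{..<p}. col j \<omega>) \<in> M \<rightarrow>\<^sub>M PiM {..<p} (\<lambda>_. N)"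
      by (intro measurable_restrict col_meas) auto
    then have "expectation (W s) = (\<integral>X. Z s X \<partial>PiM {..<p} D)"
      unfolding WZ[abs_def] distr[symmetric] by (subst integral_distr) (auto simp: Z_meas)
    with Z_bound[OF that] show ?thesis by simp
  qed
  have W_int: "integrable M (W s)" for s
    unfolding W_def using V L_int by (intro integrable_Max_finite) auto
  have W_ge: "s * (L v \<omega> - expectation (L v)) \<le> W s \<omega>" if "v \<in> V" for s v \<omega>
    unfolding W_def using V(1) that by (intro Max_ge) auto
  have L0: "L (\<lambda>_. 0) = (\<lambda>_. 0)" unfolding L_def l1_XTv_def by auto
  have W_nonneg: "0 \<le> W s \<omega>" for s \<omega>
    using W_ge[OF V(2), of s \<omega>] by (simp add: L0)
  have markov: "prob {\<omega> \<in> space M. \<tau> \<le> W s \<omega>} \<le> B / \<tau>" if "s \<in> {1, -1}" for s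
  proof -
    have "prob {\<omega> \<in> space M. \<tau> \<le> W s \<omega>} \<le> expectation (W s) / \<tau>"
      by (rule integral_Markov_inequality_measure[where A = "{}"]) (use W_int W_nonneg \<tau> in auto)
    also have "\<dots> \<le> B / \<tau>" using W_le[OF that] \<tau> by (intro divide_right_mono) auto
    finally show ?thesis .
  qed
  have [measurable]: "W s \<in> borel_measurable M" for s using W_int by (rule borel_measurable_integrable)
  have "prob {\<omega> \<in> space M. \<exists>v\<in>V. \<tau> \<le> \<bar>L v \<omega> - expectation (L v)\<bar>}
      \<le> prob ({\<omega> \<in> space M. \<tau> \<le> W 1 \<omega>} \<union> {\<omega> \<in> space M. \<tau> \<le> W (-1) \<omega>})"
  proof (rule finite_measure_mono)
    show "{\<omega> \<in> space M. \<exists>v\<in>V. \<tau> \<le> \<bar>L v \<omega> - expectation (L v)\<bar>}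
        \<subseteq> {\<omega> \<in> space M. \<tau> \<le> W 1 \<omega>} \<union> {\<omega> \<in> space M. \<tau> \<le> W (-1) \<omega>}"
    proof
      fix \<omega> assume "\<omega> \<in> {\<omega> \<in> space M. \<exists>v\<in>V. \<tau> \<le> \<bar>L v \<omega> - expectation (L v)\<bar>}"
      then obtain v where v: "\<omega> \<in> space M" "v \<in> V" "\<tau> \<le> \<bar>L v \<omega> - expectation (L v)\<bar>" by auto
      then show "\<omega> \<in> {\<omega> \<in> space M. \<tau> \<le> W 1 \<omega>} \<union> {\<omega> \<in> space M. \<tau> \<le> W (-1) \<omega>}"
        using W_ge[OF v(2), of 1 \<omega>] W_ge[OF v(2), of "-1" \<omega>] by (auto simp: abs_if split: if_splits)
    qed
  qed measurable
  also have "\<dots> \<le> prob {\<omega> \<in> space M. \<tau> \<le> W 1 \<omega>} + prob {\<omega> \<in> space M. \<tau> \<le> W (-1) \<omega>}"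
    by (rule measure_Un_le) measurable
  also have "\<dots> \<le> B / \<tau> + B / \<tau>" by (intro add_mono markov) auto
  also have "\<dots> = 4 * sqrt (p * \<theta>) * (ln (2 * real n) + mgf_bound) / \<tau>" by (simp add: B_def)
  finally show ?thesis .
qed

lemma bern_subgauss_expectation_l1_ge:
  assumes X: "bern_subgauss M n p \<theta> chi xi" and n: "0 < n" and \<theta>: "1 / real n \<le> \<theta>"
  shows "p * sqrt (\<theta> / n) / 80 * (\<Sum>i<n. \<bar>v i\<bar>)
      \<le> integral\<^sup>L M (l1_XTv n p (\<lambda>i j \<omega>. chi i j \<omega> * xi i j \<omega>) v)"
proof -
  interpret prob_space M using X by (simp add: bern_subgauss_def)
  have "p * sqrt (\<theta> / n) / 80 * (\<Sum>i<n. \<bar>v i\<bar>) = (\<Sum>j<p. sqrt (\<theta> / n) / 80 * (\<Sum>i<n. \<bar>v i\<bar>))"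
    by simp
  also have "\<dots> \<le> (\<Sum>j<p. expectation (\<lambda>\<omega>. \<bar>\<Sum>i<n. chi i j \<omega> * xi i j \<omega> * v i\<bar>))"
  proof (intro sum_mono expectation_abs_sum_ge n \<theta>)
    fix j assume "j \<in> {..<p}"
    then have j: "j < p" by simp
    show "indep_vars (\<lambda>_. borel \<Otimes>\<^sub>M borel) (\<lambda>i \<omega>. (chi i j \<omega>, xi i j \<omega>)) {..<n}"
      by (rule bern_subgauss_indep(1)[OF X j])
    show "indep_var borel (chi i j) borel (xi i j)" if "i < n" for i
      by (rule bern_subgauss_indep(2)[OF X that j])
    show "\<theta> \<le> 1" using X by (simp add: bern_subgauss_def)
  qed (use X in \<open>auto simp: bern_subgauss_def\<close>)
  also have "\<dots> = integral\<^sup>L M (l1_XTv n p (\<lambda>i j \<omega>. chi i j \<omega> * xi i j \<omega>) v)"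
    unfolding l1_XTv_def[abs_def] using bern_subgauss_entry_integrable[OF X]
    by (subst Bochner_Integration.integral_sum)
      (auto intro!: integrable_abs Bochner_Integration.integrable_sum integrable_mult_left)
  finally show ?thesis .
qed

section \<open>From finite sets to all directions\<close>

lemma l1_XTv_scale:
  assumes "0 \<le> r"
  shows "l1_XTv n p X (\<lambda>i. r * v i) \<omega> = r * l1_XTv n p X v \<omega>"
proof -
  have "(\<Sum>i<n. X i j \<omega> * (r * v i)) = r * (\<Sum>i<n. X i j \<omega> * v i)" for j
    by (simp add: sum_distrib_left mult_ac)
  then show ?thesis
    unfolding l1_XTv_def
    by (subst sum_distrib_left) (simp only: abs_mult abs_of_nonneg[OF assms])
qed

text \<open>A Lipschitz bound with a random constant. It compares a vector with a rational one at a
  single \<open>\<omega>\<close> and, once integrated, compares the two means.\<close>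

lemma l1_XTv_diff_le:
  assumes "\<And>i. i < n \<Longrightarrow> \<bar>v i - w i\<bar> \<le> \<eta>"
  shows "\<bar>l1_XTv n p X v \<omega> - l1_XTv n p X w \<omega>\<bar> \<le> \<eta> * (\<Sum>j<p. \<Sum>i<n. \<bar>X i j \<omega>\<bar>)"
proof -
  have "\<bar>l1_XTv n p X v \<omega> - l1_XTv n p X w \<omega>\<bar>
      \<le> (\<Sum>j<p. \<bar>\<bar>\<Sum>i<n. X i j \<omega> * v i\<bar> - \<bar>\<Sum>i<n. X i j \<omega> * w i\<bar>\<bar>)"
    unfolding l1_XTv_def sum_subtractf[symmetric] by (rule sum_abs)
  also have "\<dots> \<le> (\<Sum>j<p. \<Sum>i<n. \<eta> * \<bar>X i j \<omega>\<bar>)"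
  proof (rule sum_mono)
    fix j
    have "\<bar>\<bar>\<Sum>i<n. X i j \<omega> * v i\<bar> - \<bar>\<Sum>i<n. X i j \<omega> * w i\<bar>\<bar>
        \<le> \<bar>\<Sum>i<n. X i j \<omega> * (v i - w i)\<bar>"
      unfolding right_diff_distrib sum_subtractf by (rule abs_triangle_ineq3)
    also have "\<dots> \<le> (\<Sum>i<n. \<bar>X i j \<omega> * (v i - w i)\<bar>)" by (rule sum_abs)
    also have "\<dots> \<le> (\<Sum>i<n. \<eta> * \<bar>X i j \<omega>\<bar>)"
      unfolding abs_mult by (subst mult.commute, intro sum_mono mult_right_mono) (use assms in auto)
    finally show "\<bar>\<bar>\<Sum>i<n. X i j \<omega> * v i\<bar> - \<bar>\<Sum>i<n. X i j \<omega> * w i\<bar>\<bar> \<le> (\<Sum>i<n. \<eta> * \<bar>X i j \<omega>\<bar>)" .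
  qed
  finally show ?thesis by (simp add: sum_distrib_left)
qed

text \<open>Coordinates from \<open>n\<close> on are pinned to \<open>0\<close>: left free, they
  would make this set of functions on all naturals uncountable.\<close>

definition rational_ball :: "nat \<Rightarrow> (nat \<Rightarrow> real) set" where
  "rational_ball n = {w. (\<forall>i<n. w i \<in> \<rat>) \<and> (\<forall>i\<ge>n. w i = 0) \<and> (\<Sum>i<n. \<bar>w i\<bar>) \<le> 1}"

lemma countable_rational_ball: "countable (rational_ball n)"
proof (rule countable_subset)
  show "rational_ball n \<subseteq> (\<lambda>l i. if i < n then l ! i else 0) ` lists \<rat>"
  proof
    fix w assume w: "w \<in> rational_ball n"
    have "w = (\<lambda>i. if i < n then map w [0..<n] ! i else 0)"
      using w by (auto simp: rational_ball_def fun_eq_iff)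
    moreover have "map w [0..<n] \<in> lists \<rat>"
      using w by (auto simp: rational_ball_def)
    ultimately show "w \<in> (\<lambda>l i. if i < n then l ! i else 0) ` lists \<rat>" by blast
  qed
  show "countable ((\<lambda>l i. if i < n then l ! i else 0) ` lists \<rat> :: (nat \<Rightarrow> real) set)"
    by (intro countable_image countable_lists countable_rat)
qed

text \<open>Norm \<open>1 / 2\<close> leaves room for the total rounding error
  \<open>n * \<eta>\<close>, so the rational vector stays in the unit ball without
  rescaling.\<close>

lemma rational_ball_approx:
  assumes v: "(\<Sum>i<n. \<bar>v i\<bar>) \<le> 1 / 2" and \<eta>: "0 < \<eta>" "real n * \<eta> \<le> 1 / 2"
  obtains w where "w \<in> rational_ball n" "\<And>i. i < n \<Longrightarrow> \<bar>v i - w i\<bar> \<le> \<eta>"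
proof -
  have "\<exists>q\<in>\<rat>. \<bar>v i - q\<bar> \<le> \<eta>" for i
  proof -
    obtain q where "q \<in> \<rat>" "v i < q" "q < v i + \<eta>"
      using Rats_dense_in_real[of "v i" "v i + \<eta>"] \<eta> by auto
    then show ?thesis by (intro bexI[of _ q]) auto
  qed
  then obtain q where q: "\<And>i. q i \<in> \<rat>" "\<And>i. \<bar>v i - q i\<bar> \<le> \<eta>" by metis
  define w where "w i = (if i < n then q i else 0)" for i
  have "(\<Sum>i<n. \<bar>w i\<bar>) \<le> (\<Sum>i<n. \<bar>v i\<bar> + \<eta>)"
  proof (rule sum_mono)
    fix i assume "i \<in> {..<n}"
    then show "\<bar>w i\<bar> \<le> \<bar>v i\<bar> + \<eta>" using q(2)[of i] by (simp add: w_def)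
  qed
  also have "\<dots> \<le> 1" using v \<eta> by (simp add: sum.distrib)
  finally have "w \<in> rational_ball n" using q(1) by (simp add: rational_ball_def w_def)
  with that[of w] q(2) show ?thesis by (simp add: w_def)
qed

text \<open>The estimate for finite sets is uniform in the set, so it passes to the countable ball
  by continuity of the measure from below along an enumeration.\<close>

lemma deviation_rational_ball:
  fixes chi xi :: "nat \<Rightarrow> nat \<Rightarrow> 'a \<Rightarrow> real"
  assumes X: "bern_subgauss M n p \<theta> chi xi" and n: "0 < n" and p\<theta>: "1 \<le> p * \<theta>" and \<tau>: "\<tau> > 0"
  defines "L \<equiv> l1_XTv n p (\<lambda>i j \<omega>. chi i j \<omega> * xi i j \<omega>)"
  defines "A \<equiv> {\<omega> \<in> space M. \<exists>v\<in>rational_ball n. \<tau> \<le> \<bar>L v \<omega> - integral\<^sup>L M (L v)\<bar>}"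
  shows "A \<in> sets M"
    and "measure M A \<le> 4 * sqrt (p * \<theta>) * (ln (2 * real n) + mgf_bound) / \<tau>"
proof -
  interpret prob_space M using X by (simp add: bern_subgauss_def)
  have L_meas[measurable]: "L v \<in> borel_measurable M" for v
    unfolding L_def l1_XTv_def
    using bern_subgauss_entry_integrable[OF X, THEN borel_measurable_integrable] by measurable
  define e where "e = from_nat_into (rational_ball n)"
  have zero: "(\<lambda>_. 0) \<in> rational_ball n" by (simp add: rational_ball_def)
  have e_range: "range e = rational_ball n"
    unfolding e_def using zero countable_rational_ball by (intro range_from_nat_into) auto
  \<comment> \<open>The zero vector is inserted at every stage because
    \<open>deviation_finite\<close> asks for it.\<close>
  define A' where "A' k = {\<omega> \<in> space M. \<exists>v\<in>insert (\<lambda>_. 0) (e ` {..k}). \<tau> \<le> \<bar>L v \<omega> - integral\<^sup>L M (L v)\<bar>}" for k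
  have A'_sets: "A' k \<in> sets M" for k
    unfolding A'_def by measurable
  have A: "A = (\<Union>k. A' k)"
    unfolding A_def A'_def e_range[symmetric] using zero e_range by fastforce
  show "A \<in> sets M" unfolding A using A'_sets by auto
  have "incseq A'"
    unfolding A'_def by (intro incseq_SucI) (auto simp: atMost_Suc)
  then have lim: "(\<lambda>k. measure M (A' k)) \<longlonglongrightarrow> measure M A"
    unfolding A using A'_sets by (intro finite_Lim_measure_incseq) auto
  have "measure M (A' k) \<le> 4 * sqrt (p * \<theta>) * (ln (2 * real n) + mgf_bound) / \<tau>" for k
    unfolding A'_def L_def
  proof (rule deviation_finite[OF X n p\<theta>])
    fix v assume "v \<in> insert (\<lambda>_. 0) (e ` {..k})"
    then have "v \<in> rational_ball n" using zero e_range by auto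
    then show "(\<Sum>i<n. \<bar>v i\<bar>) \<le> 1" by (simp add: rational_ball_def)
  qed (use \<tau> in auto)
  then show "measure M A \<le> 4 * sqrt (p * \<theta>) * (ln (2 * real n) + mgf_bound) / \<tau>"
    by (intro LIMSEQ_le_const2[OF lim]) auto
qed

text \<open>A bad \<open>v\<close> is rescaled to norm \<open>1 / 2\<close> and then rounded to a
  rational vector that still deviates by \<open>\<tau>\<close>; so the event over all
  \<open>v\<close> lies in a measurable event over countably many.\<close>

lemma deviation_bound:
  fixes chi xi :: "nat \<Rightarrow> nat \<Rightarrow> 'a \<Rightarrow> real"
  assumes X: "bern_subgauss M n p \<theta> chi xi" and n: "0 < n" and \<theta>: "1 / real n \<le> \<theta>"
    and p\<theta>: "1 \<le> p * \<theta>" and c: "c > 0"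
  defines "L \<equiv> l1_XTv n p (\<lambda>i j \<omega>. chi i j \<omega> * xi i j \<omega>)"
  shows "\<exists>A\<in>sets M. measure M A \<le> 1280 / c * (ln (2 * real n) + mgf_bound) * sqrt (n / p) \<and>
     {\<omega> \<in> space M. \<exists>v. (\<exists>i<n. v i \<noteq> 0) \<and> \<bar>L v \<omega> - integral\<^sup>L M (L v)\<bar> \<ge> c * integral\<^sup>L M (L v)} \<subseteq> A"
proof -
  interpret prob_space M using X by (simp add: bern_subgauss_def)
  have \<theta>0: "\<theta> > 0" using X by (simp add: bern_subgauss_def)
  have p: "0 < p" using p\<theta> by (cases "p = 0") auto
  \<comment> \<open>\<open>320 = 80 * 2 * 2\<close>: the constant of the mean, the norm
    \<open>1 / 2\<close> of the rescaled vector, and one half of the deviation reserved for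
    rounding.\<close>
  define \<tau> where "\<tau> = c * (p * sqrt (\<theta> / n)) / 320"
  have \<tau>: "\<tau> > 0" unfolding \<tau>_def using c p \<theta>0 n by simp
  define A where "A = {\<omega> \<in> space M. \<exists>v\<in>rational_ball n. \<tau> \<le> \<bar>L v \<omega> - integral\<^sup>L M (L v)\<bar>}"
  note dev = deviation_rational_ball[OF X n p\<theta> \<tau>, folded L_def, folded A_def]
  have ent: "integrable M (\<lambda>\<omega>. chi i j \<omega> * xi i j \<omega>)" if "i < n" "j < p" for i j
    using bern_subgauss_entry_integrable[OF X that] .
  have L_int: "integrable M (L v)" for v
    unfolding L_def l1_XTv_def[abs_def]
    by (intro Bochner_Integration.integrable_sum integrable_abs integrable_mult_left ent) auto
  define S where "S \<omega> = (\<Sum>j<p. \<Sum>i<n. \<bar>chi i j \<omega> * xi i j \<omega>\<bar>)" for \<omega>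
  have S_int: "integrable M S"
    unfolding S_def[abs_def]
    by (intro Bochner_Integration.integrable_sum integrable_abs ent) auto
  have S_nonneg: "0 \<le> S \<omega>" for \<omega> unfolding S_def by (intro sum_nonneg) auto
  have "measure M A \<le> 4 * sqrt (p * \<theta>) * (ln (2 * real n) + mgf_bound) / \<tau>" by (rule dev)
  also have "\<dots> = 1280 / c * (ln (2 * real n) + mgf_bound) * (sqrt (p * \<theta>) / (p * sqrt (\<theta> / n)))"
    unfolding \<tau>_def using c by simp
  also have "sqrt (p * \<theta>) / (p * sqrt (\<theta> / n)) = sqrt (n / p)"
  proof -
    have "sqrt (p * \<theta>) / (p * sqrt (\<theta> / n)) = (sqrt p * sqrt n) / (sqrt p * sqrt p)"
      using p n \<theta>0 by (simp add: real_sqrt_mult real_sqrt_divide field_simps)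
    also have "\<dots> = sqrt n / sqrt p" using p by (subst mult_divide_mult_cancel_left) auto
    finally show ?thesis by (simp add: real_sqrt_divide)
  qed
  finally have "measure M A \<le> 1280 / c * (ln (2 * real n) + mgf_bound) * sqrt (n / p)" .
  moreover have "\<omega> \<in> A" if \<omega>: "\<omega> \<in> space M" and v: "i < n" "v i \<noteq> 0"
    and ge: "\<bar>L v \<omega> - expectation (L v)\<bar> \<ge> c * expectation (L v)" for \<omega> v i
  proof -
    define a where "a = (\<Sum>i<n. \<bar>v i\<bar>)"
    have "\<bar>v i\<bar> \<le> a" unfolding a_def using v by (intro member_le_sum) auto
    then have a: "a > 0" using v by linarith
    define u where "u = (\<lambda>i. 1 / (2 * a) * v i)"
    have u1: "(\<Sum>i<n. \<bar>u i\<bar>) = 1 / 2"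
      unfolding u_def abs_mult sum_distrib_left[symmetric] a_def[symmetric] using a by simp
    have Lu: "L u \<omega> = 1 / (2 * a) * L v \<omega>" for \<omega>
      unfolding L_def u_def using a by (intro l1_XTv_scale) auto
    have ELu: "expectation (L u) = 1 / (2 * a) * expectation (L v)"
      unfolding Lu[abs_def] by simp
    have "2 * \<tau> \<le> c * expectation (L u)"
      using bern_subgauss_expectation_l1_ge[OF X n \<theta>, of u] c
      unfolding u1 \<tau>_def L_def by (simp add: field_simps)
    also have "\<dots> = 1 / (2 * a) * (c * expectation (L v))" unfolding ELu by simp
    also have "\<dots> \<le> 1 / (2 * a) * \<bar>L v \<omega> - expectation (L v)\<bar>"
      using a ge by (intro mult_left_mono) auto
    also have "\<dots> = \<bar>L u \<omega> - expectation (L u)\<bar>"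
      unfolding Lu ELu using a by (simp add: abs_mult flip: right_diff_distrib diff_divide_distrib)
    finally have u_ge: "2 * \<tau> \<le> \<bar>L u \<omega> - expectation (L u)\<bar>" .
    define T where "T = S \<omega> + expectation S"
    have T: "T \<ge> 0" unfolding T_def using S_nonneg by (simp add: integral_nonneg_AE)
    \<comment> \<open>The precision may depend on \<open>\<omega>\<close>, since membership in
      \<open>A\<close> asks only for some rational vector at this \<open>\<omega>\<close>. The
      \<open>T + 1\<close> avoids division by zero.\<close>
    define \<eta> where "\<eta> = min (\<tau> / (T + 1)) (1 / (2 * n))"
    have \<eta>: "0 < \<eta>" unfolding \<eta>_def using \<tau> T n by simp
    have "n * \<eta> \<le> n * (1 / (2 * n))" unfolding \<eta>_def by (intro mult_left_mono) auto
    then have n\<eta>: "n * \<eta> \<le> 1 / 2" using n by simp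
    have "\<eta> * T \<le> \<eta> * (T + 1)" using \<eta> by simp
    also have "\<dots> \<le> \<tau> / (T + 1) * (T + 1)" unfolding \<eta>_def using T by (intro mult_right_mono) auto
    also have "\<dots> = \<tau>" using T by simp
    finally have \<eta>T: "\<eta> * T \<le> \<tau>" .
    obtain w where w: "w \<in> rational_ball n" "\<And>i. i < n \<Longrightarrow> \<bar>u i - w i\<bar> \<le> \<eta>"
      using rational_ball_approx[where n = n and v = u and \<eta> = \<eta>] u1 \<eta> n\<eta> by auto
    have diff: "\<bar>L u \<omega> - L w \<omega>\<bar> \<le> \<eta> * S \<omega>" for \<omega>
      unfolding L_def S_def by (rule l1_XTv_diff_le[OF w(2)])
    have "\<bar>expectation (L u) - expectation (L w)\<bar> = \<bar>expectation (\<lambda>\<omega>. L u \<omega> - L w \<omega>)\<bar>"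
      using L_int by simp
    also have "\<dots> \<le> expectation (\<lambda>\<omega>. \<bar>L u \<omega> - L w \<omega>\<bar>)" by (rule integral_abs_bound)
    also have "\<dots> \<le> expectation (\<lambda>\<omega>. \<eta> * S \<omega>)"
      by (intro integral_mono diff integrable_abs Bochner_Integration.integrable_diff L_int
          integrable_mult_right S_int)
    also have "\<dots> = \<eta> * expectation S" by simp
    finally have "\<bar>expectation (L u) - expectation (L w)\<bar> \<le> \<eta> * expectation S" .
    with diff[of \<omega>] u_ge \<eta>T have "\<tau> \<le> \<bar>L w \<omega> - expectation (L w)\<bar>"
      unfolding T_def distrib_left by linarith
    with w(1) \<omega> show "\<omega> \<in> A" unfolding A_def by auto
  qed
  ultimately show ?thesis using dev(1) by (intro bexI[of _ A]) auto
qed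

text \<open>The \<open>o(1)\<close> is uniform: \<open>N\<close> may depend on \<open>c\<close>,
  \<open>C\<close> and \<open>\<epsilon>\<close> but not on \<open>p\<close>,
  \<open>\<theta>\<close> or the law. Vectors vanishing on the first \<open>n\<close> coordinates
  are excluded, as both sides of the inequality are then \<open>0\<close> and it holds trivially.
  The cover \<open>A\<close> avoids any claim that the event itself is measurable.\<close>

theorem mainTheorem1:
  shows "\<forall>c::real>0. \<exists>C::real>0. \<forall>\<epsilon>::real>0. \<exists>N::nat. \<forall>n\<ge>N.
    \<forall>(p::nat) (\<theta>::real) (M::'a measure) chi xi.
      1 / real n \<le> \<theta> \<and> \<theta> \<le> 1 \<and> real p \<ge> C * real n * (ln (real n)) ^ 4 \<and>
      bern_subgauss M n p \<theta> chi xi \<longrightarrow>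
      (\<exists>A\<in>sets M. measure M A \<le> \<epsilon> \<and>
         {\<omega>\<in>space M. \<exists>v::nat \<Rightarrow> real. (\<exists>i<n. v i \<noteq> 0) \<and>
            \<bar>l1_XTv n p (\<lambda>i j \<omega>'. chi i j \<omega>' * xi i j \<omega>') v \<omega>
              - integral\<^sup>L M (l1_XTv n p (\<lambda>i j \<omega>'. chi i j \<omega>' * xi i j \<omega>') v)\<bar>
            \<ge> c * integral\<^sup>L M (l1_XTv n p (\<lambda>i j \<omega>'. chi i j \<omega>' * xi i j \<omega>') v)} \<subseteq> A)"
proof (intro allI impI, goal_cases)
  case (1 c)
  show ?case
  proof (rule exI[of _ 1], intro conjI allI impI, goal_cases)
    case (2 \<epsilon>)
    have "(\<lambda>n. 1280 / c * (ln (2 * real n) + mgf_bound) / (ln (real n))\<^sup>2) \<longlonglongrightarrow> 0"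
      by real_asymp
    then have "\<forall>\<^sub>F n in sequentially. 1280 / c * (ln (2 * real n) + mgf_bound) / (ln (real n))\<^sup>2 < \<epsilon>"
      using \<open>\<epsilon> > 0\<close> by (rule order_tendstoD)
    moreover have "\<forall>\<^sub>F n in sequentially. ln (real n) \<ge> 1" by real_asymp
    ultimately obtain N where N: "\<And>n. n \<ge> N \<Longrightarrow> ln (real n) \<ge> 1 \<and>
        1280 / c * (ln (2 * real n) + mgf_bound) / (ln (real n))\<^sup>2 < \<epsilon>"
      using eventually_conj unfolding eventually_sequentially by (metis nle_le order_trans)
    show ?case
    proof (intro exI[of _ N] allI impI)
      fix n p \<theta> and M :: "'a measure" and chi xi
      assume n: "n \<ge> N" and "1 / real n \<le> \<theta> \<and> \<theta> \<le> 1 \<and> 1 * real n * ln (real n) ^ 4 \<le> real p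
        \<and> bern_subgauss M n p \<theta> chi xi"
      then have \<theta>: "1 / real n \<le> \<theta>" and p: "real n * ln (real n) ^ 4 \<le> real p"
        and X: "bern_subgauss M n p \<theta> chi xi" by auto
      have ln1: "ln (real n) \<ge> 1" using N[OF n] by simp
      then have n0: "0 < n" by (cases "n = 0") auto
      have ln2: "0 < (ln (real n))\<^sup>2" using ln1 by auto
      have "1 \<le> ln (real n) ^ 4" using ln1 by (rule one_le_power)
      also have "\<dots> = (n * ln (real n) ^ 4) * (1 / n)" using n0 by simp
      also have "\<dots> \<le> p * \<theta>" using p \<theta> n0 by (intro mult_mono) auto
      finally have p\<theta>: "1 \<le> p * \<theta>" .
      then have p0: "0 < p" by (cases "p = 0") auto
      \<comment> \<open>Under the root the fourth power of the logarithm becomes a square: one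
        factor pays for \<open>ln (2 * real n)\<close>, the other gives the decay.\<close>
      have "n / p \<le> 1 / ((ln (real n))\<^sup>2)\<^sup>2"
        using p p0 n0 ln2 by (simp add: field_simps flip: power_mult)
      then have "sqrt (n / p) \<le> 1 / (ln (real n))\<^sup>2"
        using ln2 by (intro real_le_lsqrt) (auto simp: power_divide)
      then have "1280 / c * (ln (2 * real n) + mgf_bound) * sqrt (n / p)
          \<le> 1280 / c * (ln (2 * real n) + mgf_bound) * (1 / (ln (real n))\<^sup>2)"
        using \<open>c > 0\<close> n0 mgf_bound_pos by (intro mult_left_mono mult_nonneg_nonneg add_nonneg_nonneg) auto
      also have "\<dots> \<le> \<epsilon>" using N[OF n] by simp
      finally have le: "1280 / c * (ln (2 * real n) + mgf_bound) * sqrt (n / p) \<le> \<epsilon>" .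
      show "\<exists>A\<in>sets M. measure M A \<le> \<epsilon> \<and>
         {\<omega>\<in>space M. \<exists>v::nat \<Rightarrow> real. (\<exists>i<n. v i \<noteq> 0) \<and>
            \<bar>l1_XTv n p (\<lambda>i j \<omega>'. chi i j \<omega>' * xi i j \<omega>') v \<omega>
              - integral\<^sup>L M (l1_XTv n p (\<lambda>i j \<omega>'. chi i j \<omega>' * xi i j \<omega>') v)\<bar>
            \<ge> c * integral\<^sup>L M (l1_XTv n p (\<lambda>i j \<omega>'. chi i j \<omega>' * xi i j \<omega>') v)} \<subseteq> A"
        using deviation_bound[OF X n0 \<theta> p\<theta> \<open>c > 0\<close>] le by (meson order_trans)
    qed
  qed simp
qed

end
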